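(* Let $d\alpha$ be a standardized probability measure on $\mathbb{R}$, let $q>1$ be a real number and let $K:\mathbb{C}[x]\to L^q(\mathbb{R},d\alpha)$ be a linear operator. For integers $\ell,m\ge 0$ define $$K_{\ell,m}=\int_{\mathbb{R}} K(H_\ell)(x)\,H_m(x)\,d\alpha(x).$$ Assume that (1) $K_{0,0}=1$ and $K_{0,1}=K_{1,0}=0$; (2) $\mathrm{Re}\,K_{0,2}>-1$. Then there exists a unique operator $\mathcal{C}\in\mathfrak{C}$ such that $$\lim_{N\to\infty}\int_{\mathbb{R}^N}K_N(f_+)(\boldsymbol{x})\,g_+(\boldsymbol{x})\,d\alpha_N(\sqrt{N}\boldsymbol{x})=\int_{\mathbb{R}}\mathcal{C}(f)(x)\,g(x)\,d\gamma(x)$$ for every $f,g\in\mathbb{C}[x]$. Furthermore, for $\lambda,\omega,\tau\in\mathbb{C}$ with $\mathrm{Re}\,\tau>-1$, the representation $\mathcal{C}=M_\tau T_\omega S_\lambda$ is valid if and only if (i) $\tau=\dfrac{-K_{0,2}}{1+K_{0,2}}$, (ii) $\lambda^2=1+K_{2,0}+\tau(1+\tau)K_{1,1}^2$, (iii) $\lambda\omega=(1+\tau)K_{1,1}$.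
   Context: A probability measure on $\mathbb{R}$ is called standardized if it has zero mean, unit variance and finite moments of all orders. $d\gamma(x)=(2\pi)^{-1/2}e^{-x^2/2}dx$ is the normal distribution. $\{H_\ell\}_{\ell\ge0}$ are the monic Hermite polynomials, orthogonal with respect to $d\gamma$ ($H_0=1$, $H_1=x$, $H_{\ell+1}=xH_\ell-\ell H_{\ell-1}$). $\mathbb{C}[x]$ and $\mathbb{C}[x_1,\dots,x_N]$ are rings of polynomials with complex coefficients. For a probability measure $d\alpha$ on $\mathbb{R}$, $d\alpha_N(\boldsymbol{x})=d\alpha(x_1)\times\cdots\times d\alpha(x_N)$ is the $N$-fold product measure on $\mathbb{R}^N$, and $d\alpha_N(\sqrt N\boldsymbol{x})$ is its rescaling, i.e. $\int h(\boldsymbol{x})\,d\alpha_N(\sqrt N\boldsymbol{x})=\int h(\boldsymbol{x}/\sqrt N)\,d\alpha_N(\boldsymbol{x})$. For a function $f$ of one real variable, $f_+(\boldsymbol{x})=f(x_1+\dots+x_N)$. The operators $K_N$: for a linear operator $K:\mathbb{C}[x]\to L^q(\mathbb{R},d\alpha)$ and an integer $N>0$, $K_N:\mathbb{C}[x_1,\dots,x_N]\to L^q(\mathbb{R}^N,d\alpha_N(\sqrt N\boldsymbol{x}))$ is the linear operator $K_N=S_{N,\sqrt N}K_{N,N}K_{N,N-1}\cdots K_{N,1}S_{N,1/\sqrt N}$, where $K_{N,n}$ is $K$ applied in the $n$th variable and $S_{N,\lambda}f(x_1,\dots,x_N)=f(\lambda x_1,\dots,\lambda x_N)$. Explicitly,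 with $p_j(x)=x^j$, $K_N$ is the linear map with $$K_N\big(x_1^{j_1}\cdots x_N^{j_N}\big)(\boldsymbol{x})=N^{-(j_1+\dots+j_N)/2}\,K(p_{j_1})(\sqrt N x_1)\cdots K(p_{j_N})(\sqrt N x_N).$$ Centered Gaussian Operators: for $\omega,\lambda,\tau\in\mathbb{C}$ with $\mathrm{Re}\,\tau>-1$, $T_\omega:\mathbb{C}[x]\to\mathbb{C}[x]$ is the linear operator with $T_\omega H_\ell=\omega^\ell H_\ell$ for all $\ell\ge 0$ (with $0^0=1$); $(S_\lambda f)(x)=f(\lambda x)$; and $(M_\tau f)(x)=\sqrt{1+\tau}\,e^{-\tau x^2/2}f(x)$, with the principal branch of the square root. The family of Centered Gaussian Operators, regarded as operators on $\mathbb{C}[x]$, is $$\mathfrak{C}=\{M_\tau T_\omega S_\lambda:\ \lambda,\omega,\tau\in\mathbb{C},\ \mathrm{Re}\,\tau>-1\}.$$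
   Formalization: Adds the hypothesis that K_{1,1}=0 or (1+K_{2,0})(1+K_{0,2})^2 ≠ K_{0,2}K_{1,1}^2; otherwise (ii) forces λ=0 while (iii) requires λω≠0, and no operator in the family has the stated limit. *)

theory Defs
  imports
    "HOL-Probability.Probability"
    "HOL-Library.Poly_Mapping"
    "HOL-Computational_Algebra.Polynomial"
begin

definition standardized :: "real measure \<Rightarrow> bool" where
  "standardized \<alpha> \<longleftrightarrow>
     prob_space \<alpha> \<and> sets \<alpha> = sets borel \<and>
     (\<forall>n. integrable \<alpha> (\<lambda>x. x ^ n)) \<and>
     (\<integral>x. x \<partial>\<alpha>) = 0 \<and> (\<integral>x. x\<^sup>2 \<partial>\<alpha>) = 1"

fun hermite :: "nat \<Rightarrow> complex poly" where
  "hermite 0 = 1"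
| "hermite (Suc 0) = [:0, 1:]"
| "hermite (Suc (Suc l)) =
     [:0, 1:] * hermite (Suc l) - smult (of_nat (Suc l)) (hermite l)"

(* A linear operator from C[x] to L^q(alpha).  The value K f is a representative of its class in
   L^q, so linearity is required only almost everywhere. *)
definition linear_into_Lq :: "real measure \<Rightarrow> real \<Rightarrow> (complex poly \<Rightarrow> real \<Rightarrow> complex) \<Rightarrow> bool" where
  "linear_into_Lq \<alpha> q K \<longleftrightarrow>
     (\<forall>f. K f \<in> borel_measurable \<alpha> \<and> integrable \<alpha> (\<lambda>x. norm (K f x) powr q)) \<and>
     (\<forall>f g. AE x in \<alpha>. K (f + g) x = K f x + K g x) \<and>
     (\<forall>c f. AE x in \<alpha>. K (smult c f) x = c * K f x)"

definition matrix_coeff ::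
  "real measure \<Rightarrow> (complex poly \<Rightarrow> real \<Rightarrow> complex) \<Rightarrow> nat \<Rightarrow> nat \<Rightarrow> complex" where
  "matrix_coeff \<alpha> K l m = (\<integral>x. K (hermite l) x * poly (hermite m) (of_real x) \<partial>\<alpha>)"

(* Points of R^N are functions on {..<N}; the N variables are numbered from 0.
   rescaled_power alpha N is the measure written d alpha_N (sqrt N x): the image of the product
   measure under x |-> x / sqrt N. *)
definition rescaled_power :: "real measure \<Rightarrow> nat \<Rightarrow> (nat \<Rightarrow> real) measure" where
  "rescaled_power \<alpha> N =
     distr (Pi\<^sub>M {..<N} (\<lambda>_. \<alpha>)) (Pi\<^sub>M {..<N} (\<lambda>_. borel))
       (\<lambda>x. \<lambda>i\<in>{..<N}. x i / sqrt (real N))"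

(* Polynomials in variables indexed by nat, as finitely supported maps from exponent vectors to
   coefficients; C[x_1,...,x_N] consists of those in which only the variables below N occur. *)
type_synonym mpoly = "(nat \<Rightarrow>\<^sub>0 nat) \<Rightarrow>\<^sub>0 complex"

definition mvar :: "nat \<Rightarrow> mpoly" where
  "mvar i = Poly_Mapping.single (Poly_Mapping.single i 1) 1"

(* f(x_1 + ... + x_N), evaluated in the ring of multivariate polynomials *)
definition plus_mpoly :: "nat \<Rightarrow> complex poly \<Rightarrow> mpoly" where
  "plus_mpoly N f = poly (map_poly (Poly_Mapping.single 0) f) (\<Sum>i<N. mvar i)"

(* K_N on a monomial x^m is N^(-|m|/2) times the product of the K(x^(m_i))(sqrt N x_i), over all
   i < N including those with m_i = 0; it is extended linearly to C[x_1,...,x_N]. *)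
definition tensor_op ::
  "(complex poly \<Rightarrow> real \<Rightarrow> complex) \<Rightarrow> nat \<Rightarrow> mpoly \<Rightarrow> (nat \<Rightarrow> real) \<Rightarrow> complex" where
  "tensor_op K N P x =
     (\<Sum>m\<in>Poly_Mapping.keys P.
        Poly_Mapping.lookup P m *
        of_real (real N powr (- real (\<Sum>i<N. Poly_Mapping.lookup m i) / 2)) *
        (\<Prod>i<N. K (monom 1 (Poly_Mapping.lookup m i)) (sqrt (real N) * x i)))"

definition is_hermite_multiplier :: "complex \<Rightarrow> (complex poly \<Rightarrow> complex poly) \<Rightarrow> bool" where
  "is_hermite_multiplier \<omega> T \<longleftrightarrow>
     (\<forall>f g. T (f + g) = T f + T g) \<and> (\<forall>c f. T (smult c f) = smult c (T f)) \<and>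
     (\<forall>l. T (hermite l) = smult (\<omega> ^ l) (hermite l))"

definition T_op :: "complex \<Rightarrow> complex poly \<Rightarrow> complex poly" where
  "T_op \<omega> = (THE T. is_hermite_multiplier \<omega> T)"

definition S_op :: "complex \<Rightarrow> complex poly \<Rightarrow> complex poly" where
  "S_op c f = pcompose f [:0, c:]"

definition M_op :: "complex \<Rightarrow> complex poly \<Rightarrow> real \<Rightarrow> complex" where
  "M_op \<tau> f x = csqrt (1 + \<tau>) * exp (- \<tau> * of_real x ^ 2 / 2) * poly f (of_real x)"

definition centered_gaussian_operators :: "(complex poly \<Rightarrow> real \<Rightarrow> complex) set" where
  "centered_gaussian_operators = {M_op \<tau> \<circ> T_op \<omega> \<circ> S_op c | c \<omega> \<tau>. Re \<tau> > -1}"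

definition central_limit_of ::
  "real measure \<Rightarrow> (complex poly \<Rightarrow> real \<Rightarrow> complex) \<Rightarrow> (complex poly \<Rightarrow> real \<Rightarrow> complex) \<Rightarrow> bool" where
  "central_limit_of \<alpha> K C \<longleftrightarrow>
     (\<forall>f g :: complex poly.
        (\<lambda>N. \<integral>x. tensor_op K N (plus_mpoly N f) x * poly g (of_real (\<Sum>i<N. x i)) \<partial>rescaled_power \<alpha> N)
        \<longlonglongrightarrow> (\<integral>x. C f x * poly g (of_real x) \<partial>std_normal_distribution))"

(* T_op is well defined: the description above has exactly one solution. *)

lemma hermite_rec: "hermite (Suc l) = [:0, 1:] * hermite l - smult (of_nat l) (hermite (l - 1))"
  by (cases l) simp_all

lemma pderiv_hermite: "pderiv (hermite l) = smult (of_nat l) (hermite (l - 1))"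
proof (induction l rule: less_induct)
  case (less l)
  show ?case
  proof (cases l)
    case 0
    then show ?thesis by simp
  next
    case (Suc k)
    show ?thesis
    proof (cases k)
      case 0
      then show ?thesis using Suc by (simp add: pderiv_pCons)
    next
      case (Suc j)
      have l: "l = Suc (Suc j)" using \<open>l = Suc k\<close> Suc by simp
      have IH1: "pderiv (hermite (Suc j)) = smult (of_nat (Suc j)) (hermite j)"
        and IH2: "pderiv (hermite j) = smult (of_nat j) (hermite (j - 1))"
        using less.IH[of "Suc j"] less.IH[of j] l by simp_all
      have x1: "pderiv ([:0, 1:] :: complex poly) = 1" by (simp add: pderiv_pCons)
      have "pderiv (hermite l) = hermite (Suc j)
          + smult (of_nat (Suc j)) ([:0, 1:] * hermite j - smult (of_nat j) (hermite (j - 1)))"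
        unfolding l hermite.simps
        by (simp only: pderiv_diff pderiv_mult pderiv_smult IH1 IH2 x1)
           (simp add: algebra_simps smult_diff_right)
      also have "\<dots> = hermite (Suc j) + smult (of_nat (Suc j)) (hermite (Suc j))"
        by (simp only: hermite_rec[of j])
      also have "\<dots> = smult (of_nat l) (hermite (l - 1))"
        by (rule poly_eqI) (simp add: l algebra_simps)
      finally show ?thesis .
    qed
  qed
qed

lemma degree_hermite: "degree (hermite l) = l" and lead_coeff_hermite: "coeff (hermite l) l = 1"
proof -
  have "degree (hermite l) = l \<and> coeff (hermite l) l = 1"
  proof (induction l rule: hermite.induct)
    case (3 l)
    have d: "degree (smult (of_nat (Suc l)) (hermite l)) < Suc (Suc l)"
      using 3 degree_smult_le[of "of_nat (Suc l)" "hermite l"] by linarith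
    have c: "coeff (hermite (Suc (Suc l))) (Suc (Suc l)) = 1"
      using 3 coeff_eq_0[OF d] by (simp add: coeff_eq_0)
    have "degree ([:0, 1:] * hermite (Suc l)) \<le> Suc (Suc l)"
      using 3 degree_mult_le[of "[:0, 1:]" "hermite (Suc l)"] by simp
    then have "degree (hermite (Suc (Suc l))) \<le> Suc (Suc l)"
      unfolding hermite.simps using d by (intro degree_diff_le) auto
    with c le_degree[of "hermite (Suc (Suc l))" "Suc (Suc l)"] show ?case by simp
  qed simp_all
  then show "degree (hermite l) = l" "coeff (hermite l) l = 1" by auto
qed

lemma is_hermite_multiplier_unique:
  assumes S: "is_hermite_multiplier \<omega> S" and T: "is_hermite_multiplier \<omega> T"
  shows "S = T"
proof
  fix f
  show "S f = T f"
  proof (induction "degree f" arbitrary: f rule: less_induct)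
    case less
    define n where "n = degree f"
    define g where "g = f - smult (coeff f n) (hermite n)"
    have f: "f = g + smult (coeff f n) (hermite n)" by (simp add: g_def)
    have "S g = T g"
    proof (cases "n = 0")
      case True
      obtain a where "f = [:a:]" using True n_def degree_eq_zeroE by metis
      then have "g = 0" using True by (simp add: g_def)
      moreover have "S (smult 0 0) = smult 0 (S 0)" "T (smult 0 0) = smult 0 (T 0)"
        using S T unfolding is_hermite_multiplier_def by blast+
      ultimately show ?thesis by simp
    next
      case False
      have "degree g \<le> n"
        unfolding g_def using degree_hermite[of n] degree_smult_le[of "coeff f n" "hermite n"]
        by (intro degree_diff_le) (auto simp: n_def)
      moreover have "coeff g n = 0" by (simp add: g_def lead_coeff_hermite)
      ultimately have "degree g < n"
        using False by (metis degree_0 le_neq_implies_less leading_coeff_0_iff neq0_conv)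
      then show ?thesis using less n_def by simp
    qed
    then show ?case
      using S T by (subst (1 2) f) (simp only: is_hermite_multiplier_def)
  qed
qed

lemma is_hermite_multiplier_exists: "\<exists>T. is_hermite_multiplier \<omega> T"
proof -
  define u :: "nat \<Rightarrow> complex poly \<times> complex poly" where
    "u = rec_nat (1, 0) (\<lambda>n (a, b). (smult \<omega> ([:0, 1:] * a) + smult ((1 - \<omega>\<^sup>2) * of_nat n) b, a))"
  define T where "T f = (\<Sum>i\<le>degree f. smult (coeff f i) (fst (u i)))" for f
  have T_ge: "T f = (\<Sum>i\<le>n. smult (coeff f i) (fst (u i)))" if "degree f \<le> n" for f n
    unfolding T_def using that by (intro sum.mono_neutral_left) (auto simp: coeff_eq_0)
  have add: "T (f + g) = T f + T g" for f g
    using T_ge[of f "max (degree f) (degree g)"] T_ge[of g "max (degree f) (degree g)"]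
      T_ge[of "f + g" "max (degree f) (degree g)"] degree_add_le_max[of f g]
    by (simp add: smult_add_left sum.distrib)
  have scale: "T (smult c f) = smult c (T f)" for c f
    using T_ge[of "smult c f" "degree f"] T_ge[of f "degree f"] degree_smult_le[of c f]
    by (intro poly_eqI) (simp add: coeff_sum sum_distrib_left mult_ac)
  have u0: "fst (u 0) = 1" by (simp add: u_def)
  have u_Suc: "fst (u (Suc n)) = smult \<omega> ([:0, 1:] * fst (u n))
      + smult ((1 - \<omega>\<^sup>2) * of_nat n) (fst (u (n - 1)))" for n
    by (cases n) (simp_all add: u_def case_prod_unfold)
  have T_monom: "T (monom c n) = smult c (fst (u n))" for c n
  proof -
    have "T (monom c n) = (\<Sum>i\<le>n. smult (coeff (monom c n) i) (fst (u i)))"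
      by (intro T_ge degree_monom_le)
    also have "\<dots> = (\<Sum>i\<le>n. if i = n then smult c (fst (u i)) else 0)"
      by (intro sum.cong) auto
    finally show ?thesis by simp
  qed
  have T_x: "T ([:0, 1:] * f) = smult \<omega> ([:0, 1:] * T f) + smult (1 - \<omega>\<^sup>2) (T (pderiv f))"
    (is "?L f = ?R f") for f
  proof -
    have mon: "?L (monom c n) = ?R (monom c n)" for c n
    proof -
      have "[:0, 1:] * monom c n = monom c (Suc n)"
        by (simp add: monom_Suc)
      then show ?thesis
        by (simp add: T_monom pderiv_monom u_Suc smult_add_right mult_ac)
    qed
    have sums: "?L (\<Sum>i\<le>n. monom (coeff f i) i) = ?R (\<Sum>i\<le>n. monom (coeff f i) i)" for n
    proof (induction n)
      case 0
      show ?case using mon[of "coeff f 0" 0] by simp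
    next
      case (Suc n)
      have "?L (p + q) = ?L p + ?L q" "?R (p + q) = ?R p + ?R q" for p q
        by (simp_all only: distrib_left add pderiv_add smult_add_right add_ac)
      then show ?case
        by (simp only: sum.atMost_Suc Suc.IH mon)
    qed
    show ?thesis
      using sums[of "degree f"] by (simp only: poly_as_sum_of_monoms)
  qed
  have "T (hermite l) = smult (\<omega> ^ l) (hermite l)" for l
  proof (induction l rule: less_induct)
    case (less l)
    show ?case
    proof (cases l)
      case 0
      have "T (monom 1 0) = 1" by (simp only: T_monom u0 smult_1_left)
      then show ?thesis using 0 by (simp add: monom_0 one_pCons)
    next
      case (Suc k)
      have minus: "T (f - g) = T f - T g" for f g
        using add[of f "smult (-1) g"] scale[of "-1" g] by simp
      have IH: "T (hermite k) = smult (\<omega> ^ k) (hermite k)"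
          "T (hermite (k - 1)) = smult (\<omega> ^ (k - 1)) (hermite (k - 1))"
        using less.IH[of k] less.IH[of "k - 1"] Suc by auto
      have pow: "\<omega>\<^sup>2 * (of_nat k * \<omega> ^ (k - 1)) = \<omega> ^ l * of_nat k"
        by (cases k) (simp_all add: Suc power2_eq_square)
      have "T (hermite l) = smult \<omega> (smult (\<omega> ^ k) ([:0, 1:] * hermite k))
          + smult (1 - \<omega>\<^sup>2) (smult (of_nat k) (smult (\<omega> ^ (k - 1)) (hermite (k - 1))))
          - smult (of_nat k) (smult (\<omega> ^ (k - 1)) (hermite (k - 1)))"
        unfolding Suc hermite_rec[of k] minus T_x pderiv_hermite scale IH by simp
      also have "\<dots> = smult (\<omega> ^ l) ([:0, 1:] * hermite k)
          - smult (\<omega>\<^sup>2 * (of_nat k * \<omega> ^ (k - 1))) (hermite (k - 1))"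
        unfolding Suc by (rule poly_eqI) (simp add: algebra_simps del: mult_pCons_left)
      also have "\<dots> = smult (\<omega> ^ l) (hermite l)"
        unfolding pow unfolding Suc hermite_rec[of k] by (simp add: smult_diff_right)
      finally show ?thesis .
    qed
  qed
  with add scale have "is_hermite_multiplier \<omega> T"
    unfolding is_hermite_multiplier_def by blast
  then show ?thesis by blast
qed

lemma is_hermite_multiplier_T_op: "is_hermite_multiplier \<omega> (T_op \<omega>)"
  unfolding T_op_def
  using is_hermite_multiplier_exists is_hermite_multiplier_unique by (metis theI)


(* The inequation on the right-hand side is exactly the condition under which some M_tau T_omega S_c
   has the parameters prescribed by the central limit theorem.  It can only fail when c is forced
   to be 0 while c * omega is forced to be nonzero. *)
lemma gaussian_parameters_exist_iff:
  fixes k11 k20 k02 :: complex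
  assumes "Re k02 > -1"
  shows "(\<exists>c \<omega> \<tau>. Re \<tau> > -1 \<and> \<tau> = - k02 / (1 + k02) \<and>
            c\<^sup>2 = 1 + k20 + \<tau> * (1 + \<tau>) * k11\<^sup>2 \<and> c * \<omega> = (1 + \<tau>) * k11) \<longleftrightarrow>
         (k11 \<noteq> 0 \<longrightarrow> (1 + k20) * (1 + k02)\<^sup>2 \<noteq> k02 * k11\<^sup>2)"
proof -
  define \<tau> where "\<tau> = - k02 / (1 + k02)"
  define d where "d = 1 + k20 + \<tau> * (1 + \<tau>) * k11\<^sup>2"
  have "Re (1 + k02) > 0" using assms by simp
  then have nz: "1 + k02 \<noteq> 0" by (metis less_irrefl zero_complex.sel(1))
  have tau1: "1 + \<tau> = 1 / (1 + k02)" using nz by (simp add: \<tau>_def field_simps)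
  have "Re (1 / z) > 0" if "Re z > 0" for z
    using that by (simp add: Re_divide sum_power2_gt_zero_iff)
  then have "Re (1 + \<tau>) > 0"
    unfolding tau1 using \<open>Re (1 + k02) > 0\<close> by blast
  then have Re: "Re \<tau> > -1" by simp
  have "d * (1 + k02)\<^sup>2 = (1 + k20) * (1 + k02)\<^sup>2 - k02 * k11\<^sup>2"
  proof -
    have "\<tau> * (1 + k02) = - k02" "(1 + \<tau>) * (1 + k02) = 1"
      using nz tau1 by (simp_all add: \<tau>_def)
    then show ?thesis unfolding d_def by algebra
  qed
  then have d0: "d = 0 \<longleftrightarrow> (1 + k20) * (1 + k02)\<^sup>2 = k02 * k11\<^sup>2"
    using nz by (metis eq_iff_diff_eq_0 mult_eq_0_iff power_not_zero)
  have "(\<exists>c \<omega>. c\<^sup>2 = d \<and> c * \<omega> = (1 + \<tau>) * k11) \<longleftrightarrow> (k11 \<noteq> 0 \<longrightarrow> d \<noteq> 0)"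
  proof
    assume "\<exists>c \<omega>. c\<^sup>2 = d \<and> c * \<omega> = (1 + \<tau>) * k11"
    then show "k11 \<noteq> 0 \<longrightarrow> d \<noteq> 0" using tau1 nz by auto
  next
    assume *: "k11 \<noteq> 0 \<longrightarrow> d \<noteq> 0"
    have "(csqrt d)\<^sup>2 = d \<and> csqrt d * ((1 + \<tau>) * k11 / csqrt d) = (1 + \<tau>) * k11"
      using * by auto
    then show "\<exists>c \<omega>. c\<^sup>2 = d \<and> c * \<omega> = (1 + \<tau>) * k11" by blast
  qed
  then show ?thesis using Re d0 unfolding d_def \<tau>_def by auto
qed

end

theory Submission
  imports
    Defs
    "HOL-Computational_Algebra.Formal_Power_Series"
    "HOL-Analysis.Generalised_Binomial_Theorem"
begin

text \<open>
  Both sides of the limit formula are bilinear forms in \<open>(f, g)\<close>, so they are determined by their values on pairs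
  of monomials \<open>(x ^ l, x ^ m)\<close>.  It is shown that each of them is a Gaussian form: the values on monomials are
  the mixed moments of a formal centered Gaussian pair with covariance parameters \<open>P\<close>, \<open>Q\<close>, \<open>R\<close>
  (\<open>gaussian_form\<close>).  Such a form determines its parameters, so the theorem becomes a comparison of three complex
  numbers.

  For the left-hand side, let \<open>W N\<close> be the exponential generating function, in two formal variables, of the numbers
  \<open>\<integral> K (x ^ k) * x ^ j \<partial>\<alpha>\<close>, divided by \<open>sqrt N ^ (k + j)\<close>.  As the coordinates are independent and \<open>f\<^sub>+\<close>, \<open>g\<^sub>+\<close> are
  functions of the sum of the coordinates, the integral is, up to factorials, a coefficient of \<open>W N ^ N\<close>
  (\<open>integral_tensor_op\<close>).
  The assumptions on \<open>K\<close> say that \<open>W N = 1 + q / N + O(N powr (- 3 / 2))\<close> with a quadratic form \<open>q\<close>, so every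
  coefficient of \<open>W N ^ N\<close> converges to that of \<open>exp q\<close>.  The differential equation
  of \<open>W N ^ N\<close> gives this convergence by induction on the degree (\<open>tendsto_fps_power_of_triangular_array\<close>).

  For the right-hand side, \<open>M_op \<tau>\<close> turns the normal distribution into a Gaussian weight of complex variance
  \<open>1 / (1 + \<tau>)\<close>.  Its moments are those of a real Gaussian continued to complex parameters
  (\<open>gaussian_weight_even_moment\<close>), hence the weight satisfies integration by parts.  Together with the commutation
  relations of \<open>T_op \<omega>\<close> and \<open>S_op c\<close> with multiplication by \<open>x\<close> and with differentiation, this yields the recursion
  of a Gaussian form (\<open>gaussian_functional_TS_op\<close>).

  Comparing parameters gives exactly the three equations of the theorem (\<open>gaussian_parameters_iff\<close>), which are
  solvable by the nondegeneracy assumption.  Their solutions all represent the same operator, since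
  \<open>T_op \<omega> \<circ> S_op c\<close> depends only on \<open>c\<^sup>2\<close> and \<open>c * \<omega>\<close> (\<open>TS_op_eqI\<close>).
\<close>

unbundle no vec_syntax
unbundle fps_syntax

section \<open>Linear functionals on polynomials in several variables\<close>

text \<open>
  The values may lie in any commutative ring to which the scalars are mapped by \<open>h\<close>.  Besides \<open>\<complex>\<close> itself, the
  ring of power series occurs; there, a functional can have the whole generating function of other functionals
  as its value.
\<close>

definition poly_functional ::
  "(complex \<Rightarrow> 'r) \<Rightarrow> ((nat \<Rightarrow>\<^sub>0 nat) \<Rightarrow> 'r) \<Rightarrow> mpoly \<Rightarrow> 'r::comm_ring_1" where
  "poly_functional h w P = (\<Sum>m\<in>Poly_Mapping.keys P. h (Poly_Mapping.lookup P m) * w m)"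

locale complex_algebra =
  fixes h :: "complex \<Rightarrow> 'r::comm_ring_1"
  assumes h_add: "h (a + b) = h a + h b"
    and h_mult: "h (a * b) = h a * h b"
    and h_one: "h 1 = 1"
begin

lemma h_zero: "h 0 = 0"
  using h_add[of 0 0] by simp

lemma h_of_nat: "h (of_nat n) = of_nat n"
  by (induction n) (simp_all add: h_zero h_one h_add)

lemma poly_functional_superset:
  assumes "finite A" "Poly_Mapping.keys P \<subseteq> A"
  shows "poly_functional h w P = (\<Sum>m\<in>A. h (Poly_Mapping.lookup P m) * w m)"
  unfolding poly_functional_def using assms
  by (intro sum.mono_neutral_left) (auto simp: in_keys_iff h_zero)

lemma poly_functional_add:
  "poly_functional h w (P + Q) = poly_functional h w P + poly_functional h w Q"
proof -
  have fin: "finite (Poly_Mapping.keys P \<union> Poly_Mapping.keys Q)" by simp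
  show ?thesis
    using poly_functional_superset[OF fin, of P w] poly_functional_superset[OF fin, of Q w]
      poly_functional_superset[OF fin keys_add, of w]
    by (simp add: lookup_add h_add algebra_simps sum.distrib)
qed

lemma poly_functional_zero: "poly_functional h w 0 = 0"
  by (simp add: poly_functional_def)

lemma poly_functional_sum:
  "poly_functional h w (sum P A) = (\<Sum>i\<in>A. poly_functional h w (P i))"
  by (induction A rule: infinite_finite_induct)
     (simp_all add: poly_functional_add poly_functional_zero)

lemma poly_functional_single:
  "poly_functional h w (Poly_Mapping.single m c) = h c * w m"
  by (simp add: poly_functional_def h_zero)

text \<open>
  Multiplication by a monomial is absorbed into a shift of the weight.  This is what makes it possible
  to argue by induction on the exponent of a power without listing its monomials.
\<close>

lemma poly_functional_single_mult:
  "poly_functional h w (Poly_Mapping.single k c * P) = h c * poly_functional h (\<lambda>m. w (k + m)) P"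
proof -
  have P: "(\<Sum>m\<in>Poly_Mapping.keys P. Poly_Mapping.single m (Poly_Mapping.lookup P m)) = P"
  proof (rule poly_mapping_eqI)
    fix m
    show "Poly_Mapping.lookup
        (\<Sum>m\<in>Poly_Mapping.keys P. Poly_Mapping.single m (Poly_Mapping.lookup P m)) m
        = Poly_Mapping.lookup P m"
      by (simp add: lookup_sum lookup_single when_def in_keys_iff)
  qed
  have "poly_functional h w (Poly_Mapping.single k c * P)
      = poly_functional h w (\<Sum>m\<in>Poly_Mapping.keys P.
          Poly_Mapping.single (k + m) (c * Poly_Mapping.lookup P m))"
    by (subst P[symmetric]) (simp only: sum_distrib_left mult_single)
  then show ?thesis
    unfolding poly_functional_sum poly_functional_single
    by (simp add: poly_functional_def h_mult sum_distrib_left mult_ac)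
qed

lemma poly_functional_one: "poly_functional h w 1 = w 0"
  using poly_functional_single[of w 0 1] by (simp add: h_one)

definition egf :: "(nat \<Rightarrow> 'r) \<Rightarrow> 'r fps" where
  "egf \<phi> = Abs_fps (\<lambda>k. h (1 / fact k) * \<phi> k)"

lemma fps_deriv_egf: "fps_deriv (egf \<phi>) = egf (\<lambda>k. \<phi> (Suc k))"
proof (rule fps_ext)
  fix n
  have "h (of_nat (Suc n) * (1 / fact (Suc n))) = h (1 / fact n)"
    by (simp add: fact_Suc field_simps del: of_nat_Suc)
  then have "of_nat (Suc n) * h (1 / fact (Suc n)) = h (1 / fact n)"
    unfolding h_mult h_of_nat .
  then show "fps_deriv (egf \<phi>) $ n = egf (\<lambda>k. \<phi> (Suc k)) $ n"
    by (simp add: egf_def mult.assoc[symmetric] del: of_nat_Suc)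
qed

lemma egf_nth_0: "egf \<phi> $ 0 = \<phi> 0"
  by (simp add: egf_def h_one)

end

lemma fps_deriv_prod:
  fixes f :: "'i \<Rightarrow> 'a::comm_ring_1 fps"
  assumes "finite A"
  shows "fps_deriv (prod f A) = (\<Sum>i\<in>A. fps_deriv (f i) * prod f (A - {i}))"
  using assms
proof (induction A rule: finite_induct)
  case (insert a A)
  have "prod f (insert a A - {i}) = f a * prod f (A - {i})" if "i \<in> A" for i
  proof -
    have "insert a A - {i} = insert a (A - {i})" using that insert by auto
    then show ?thesis using insert by simp
  qed
  then have "(\<Sum>i\<in>A. fps_deriv (f i) * prod f (insert a A - {i}))
      = f a * (\<Sum>i\<in>A. fps_deriv (f i) * prod f (A - {i}))"
    by (simp add: sum_distrib_left mult_ac)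
  moreover have "insert a A - {a} = A" using insert by auto
  ultimately show ?case using insert by (simp add: mult_ac)
qed simp

lemma fps_prod_nth_0: "(\<Prod>i\<in>A. f i) $ 0 = (\<Prod>i\<in>A. f i $ 0)"
  for f :: "'i \<Rightarrow> 'a::comm_ring_1 fps"
  by (induction A rule: infinite_finite_induct) simp_all

abbreviation prod_weight :: "nat \<Rightarrow> (nat \<Rightarrow> nat \<Rightarrow> 'r::comm_ring_1) \<Rightarrow> (nat \<Rightarrow>\<^sub>0 nat) \<Rightarrow> 'r" where
  "prod_weight N \<phi> \<equiv> (\<lambda>m. \<Prod>i<N. \<phi> i (Poly_Mapping.lookup m i))"

lemma (in complex_algebra) poly_functional_var_sum_Suc:
  "poly_functional h w ((\<Sum>i<N. mvar i) ^ Suc l)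
    = (\<Sum>i<N. poly_functional h (\<lambda>m. w (Poly_Mapping.single i 1 + m)) ((\<Sum>i<N. mvar i) ^ l))"
proof -
  have "(\<Sum>i<N. mvar i) ^ Suc l = (\<Sum>i<N. mvar i * (\<Sum>i<N. mvar i) ^ l)"
    by (simp only: power_Suc sum_distrib_right)
  then show ?thesis
    by (simp only: poly_functional_sum mvar_def poly_functional_single_mult h_one mult_1_left)
qed

text \<open>
  A multinomial theorem in generating function form.  Expanding one more factor \<open>x\<^sub>0 + \<dots> + x\<^bsub>N-1\<^esub>\<close>
  shifts the sequence \<open>\<phi> i\<close> for one \<open>i\<close> at a time.  A shift of a sequence is the derivative of its
  exponential generating function, so the sum of these shifts is Leibniz' rule for the product.
\<close>

lemma (in complex_algebra) poly_functional_var_sum_power: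
  "poly_functional h (prod_weight N \<phi>) ((\<Sum>i<N. mvar i) ^ l)
    = of_nat (fact l) * (\<Prod>i<N. egf (\<phi> i)) $ l"
proof (induction l arbitrary: \<phi>)
  case 0
  show ?case by (simp add: poly_functional_one fps_prod_nth_0 egf_nth_0)
next
  case (Suc l)
  define \<phi>' where "\<phi>' i = \<phi>(i := (\<lambda>k. \<phi> i (Suc k)))" for i
  have shift: "(\<lambda>m. prod_weight N \<phi> (Poly_Mapping.single i 1 + m)) = prod_weight N (\<phi>' i)" for i
    by (intro ext prod.cong) (auto simp: \<phi>'_def lookup_add lookup_single when_def)
  have prod': "(\<Prod>j<N. egf (\<phi>' i j)) = fps_deriv (egf (\<phi> i)) * (\<Prod>j\<in>{..<N} - {i}. egf (\<phi> j))"
    if "i < N" for i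
  proof -
    have "(\<Prod>j<N. egf (\<phi>' i j)) = egf (\<phi>' i i) * (\<Prod>j\<in>{..<N} - {i}. egf (\<phi>' i j))"
      using that by (intro prod.remove) auto
    also have "(\<Prod>j\<in>{..<N} - {i}. egf (\<phi>' i j)) = (\<Prod>j\<in>{..<N} - {i}. egf (\<phi> j))"
      by (intro prod.cong) (auto simp: \<phi>'_def)
    finally show ?thesis by (simp add: \<phi>'_def fps_deriv_egf)
  qed
  have "poly_functional h (prod_weight N \<phi>) ((\<Sum>i<N. mvar i) ^ Suc l)
      = (\<Sum>i<N. of_nat (fact l) * (\<Prod>j<N. egf (\<phi>' i j)) $ l)"
    by (simp only: poly_functional_var_sum_Suc shift Suc.IH)
  also have "\<dots> = of_nat (fact l) * (\<Sum>i<N. \<Prod>j<N. egf (\<phi>' i j)) $ l"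
    by (simp only: fps_sum_nth sum_distrib_left)
  also have "(\<Sum>i<N. \<Prod>j<N. egf (\<phi>' i j)) = fps_deriv (\<Prod>i<N. egf (\<phi> i))"
    by (subst fps_deriv_prod) (auto intro!: sum.cong simp: prod')
  also have "of_nat (fact l) * fps_deriv (\<Prod>i<N. egf (\<phi> i)) $ l
      = of_nat (fact (Suc l)) * (\<Prod>i<N. egf (\<phi> i)) $ Suc l"
    by (simp add: algebra_simps)
  finally show ?case .
qed

interpretation complex_self: complex_algebra "\<lambda>z::complex. z"
  by unfold_locales simp_all

interpretation complex_fps: complex_algebra "fps_const :: complex \<Rightarrow> complex fps"
  by unfold_locales simp_all

text \<open>
  Point evaluation is the functional whose weights are the values of the monomials; the factor \<open>c\<close>
  collects the coordinates that are split off in the induction.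
\<close>

lemma power_var_sum_eval:
  fixes x :: "nat \<Rightarrow> complex"
  shows "poly_functional (\<lambda>z. z) (\<lambda>m. c * prod_weight N (\<lambda>i k. x i ^ k) m) ((\<Sum>i<N. mvar i) ^ l)
    = c * (\<Sum>i<N. x i) ^ l"
proof (induction l arbitrary: c)
  case 0
  show ?case by (simp add: complex_self.poly_functional_one)
next
  case (Suc l)
  have shift: "(\<lambda>m. c * prod_weight N (\<lambda>i k. x i ^ k) (Poly_Mapping.single i 1 + m))
      = (\<lambda>m. (c * x i) * prod_weight N (\<lambda>i k. x i ^ k) m)" if "i < N" for i
  proof
    fix m
    have "prod_weight N (\<lambda>i k. x i ^ k) (Poly_Mapping.single i 1 + m)
        = (\<Prod>j<N. x j ^ Poly_Mapping.lookup (Poly_Mapping.single i 1) j) *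
          prod_weight N (\<lambda>i k. x i ^ k) m"
      by (simp add: lookup_add power_add prod.distrib)
    also have "(\<Prod>j<N. x j ^ Poly_Mapping.lookup (Poly_Mapping.single i 1) j)
        = (\<Prod>j<N. if j = i then x j else 1)"
      by (intro prod.cong) (auto simp: lookup_single when_def)
    finally show "c * prod_weight N (\<lambda>i k. x i ^ k) (Poly_Mapping.single i 1 + m)
      = (c * x i) * prod_weight N (\<lambda>i k. x i ^ k) m"
      using that by simp
  qed
  have "poly_functional (\<lambda>z. z) (\<lambda>m. c * prod_weight N (\<lambda>i k. x i ^ k) m)
      ((\<Sum>i<N. mvar i) ^ Suc l) = (\<Sum>i<N. (c * x i) * (\<Sum>i<N. x i) ^ l)"
    unfolding complex_self.poly_functional_var_sum_Suc
    by (intro sum.cong refl) (subst shift, simp, rule Suc.IH)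
  then show ?case
    by (simp add: sum_distrib_left sum_distrib_right mult_ac)
qed

section \<open>Powers of a triangular array of power series\<close>

text \<open>
  A power series in two variables is a power series whose coefficients are power series: the outer
  index belongs to the first argument of a bilinear form, the inner one to the second.
\<close>

lemma of_nat_fps_mult_nth: "(of_nat n * f) $ k = of_nat n * f $ k"
  for f :: "'a::comm_ring_1 fps"
  by (simp add: fps_of_nat[symmetric])

lemma fps_fps_mult_nth: "(f * g) $ l $ m = (\<Sum>i=0..l. \<Sum>j=0..m. f $ i $ j * g $ (l - i) $ (m - j))"
  for f g :: "'a::comm_ring_1 fps fps"
  by (simp add: fps_mult_nth fps_sum_nth)

lemma fps_deriv_nth_nth: "fps_deriv f $ n $ m = of_nat (Suc n) * f $ Suc n $ m"
  for f :: "'a::comm_ring_1 fps fps"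
  by (simp only: fps_deriv_nth of_nat_fps_mult_nth Suc_eq_plus1)

lemma tendsto_of_nat_diff_ratio: "(\<lambda>N. of_nat (N - s) / of_nat N :: complex) \<longlonglongrightarrow> 1"
proof -
  have "(\<lambda>N. 1 - complex_of_real (real s / real N)) \<longlonglongrightarrow> 1 - of_real 0"
    by (intro tendsto_intros lim_const_over_n)
  then have "(\<lambda>N. 1 - complex_of_real (real s / real N)) \<longlonglongrightarrow> 1" by simp
  then show ?thesis
  proof (rule Lim_transform_eventually)
    show "\<forall>\<^sub>F N in sequentially.
        1 - complex_of_real (real s / real N) = of_nat (N - s) / of_nat N"
      using eventually_gt_at_top[of s]
      by eventually_elim (simp add: of_nat_diff field_simps)
  qed
qed

text \<open>
  The algebraic core of the central limit theorem: if \<open>W N = 1 + q / N + \<dots>\<close>, then \<open>W N ^ N\<close> tends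
  coefficientwise to \<open>\<Lambda> = exp q\<close>.  Here \<open>q\<close> enters through its derivatives \<open>a\<close> (in the outer variable)
  and \<open>b\<close> (in the inner variable, along outer degree \<open>0\<close>), and \<open>\<Lambda>\<close> through the differential equations of
  the exponential.  Since \<open>(W ^ N)' = N W' W ^ (N - 1)\<close>, the coefficients of total degree \<open>d + 1\<close> converge as
  soon as those of degree at most \<open>d\<close> do.  The derivative lowers the exponent by one without changing
  \<open>W N\<close>, which is why the induction carries the offset \<open>s\<close>.
\<close>

lemma tendsto_fps_power_of_triangular_array:
  fixes W :: "nat \<Rightarrow> complex fps fps" and a \<Lambda> :: "complex fps fps" and b :: "complex fps"
  assumes W_one: "\<forall>\<^sub>F N in sequentially. W N $ 0 $ 0 = 1"
    and W_a: "\<And>i j. (\<lambda>N. of_nat N * fps_deriv (W N) $ i $ j) \<longlonglongrightarrow> a $ i $ j"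
    and W_b: "\<And>j. (\<lambda>N. of_nat N * fps_deriv (W N $ 0) $ j) \<longlonglongrightarrow> b $ j"
    and \<Lambda>_one: "\<Lambda> $ 0 $ 0 = 1"
    and \<Lambda>_a: "fps_deriv \<Lambda> = a * \<Lambda>"
    and \<Lambda>_b: "fps_deriv (\<Lambda> $ 0) = b * \<Lambda> $ 0"
  shows "(\<lambda>N. (W N ^ (N - s)) $ l $ m) \<longlonglongrightarrow> \<Lambda> $ l $ m"
proof (induction "l + m" arbitrary: l m s rule: less_induct)
  case less
  consider (zero) "l = 0" "m = 0" | (inner) m' where "l = 0" "m = Suc m'" | (outer) l' where "l = Suc l'"
    by (metis not0_implies_Suc)
  then show ?case
  proof cases
    case zero
    have "\<forall>\<^sub>F N in sequentially. 1 = (W N ^ (N - s)) $ l $ m"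
      using W_one unfolding zero by eventually_elim (simp add: fps_power_zeroth)
    then show ?thesis
      using tendsto_const[of 1] unfolding zero \<Lambda>_one by (rule Lim_transform_eventually[rotated])
  next
    case outer
    define F where "F N = (\<Sum>i=0..l'. \<Sum>j=0..m.
      (of_nat N * fps_deriv (W N) $ i $ j) * (W N ^ (N - Suc s)) $ (l' - i) $ (m - j))" for N
    have "(\<lambda>N. (of_nat (N - s) / of_nat N) * F N / of_nat (Suc l')) \<longlonglongrightarrow>
        1 * (\<Sum>i=0..l'. \<Sum>j=0..m. a $ i $ j * \<Lambda> $ (l' - i) $ (m - j)) / of_nat (Suc l')"
      unfolding F_def
      by (intro tendsto_intros tendsto_of_nat_diff_ratio W_a less.hyps) (auto simp: outer simp del: of_nat_Suc)
    also have "(\<Sum>i=0..l'. \<Sum>j=0..m. a $ i $ j * \<Lambda> $ (l' - i) $ (m - j))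
        = fps_deriv \<Lambda> $ l' $ m"
      by (simp only: \<Lambda>_a fps_fps_mult_nth)
    also have "1 * \<dots> / of_nat (Suc l') = \<Lambda> $ l $ m"
      by (simp only: outer mult_1_left fps_deriv_nth_nth
          nonzero_mult_div_cancel_left[OF of_nat_neq_0])
    finally show ?thesis
    proof (rule Lim_transform_eventually)
      show "\<forall>\<^sub>F N in sequentially.
          (of_nat (N - s) / of_nat N) * F N / of_nat (Suc l') = (W N ^ (N - s)) $ l $ m"
        using eventually_gt_at_top[of 0]
      proof eventually_elim
        case (elim N)
        have "of_nat (Suc l') * (W N ^ (N - s)) $ l $ m = fps_deriv (W N ^ (N - s)) $ l' $ m"
          by (simp add: outer fps_deriv_nth_nth del: fps_deriv_nth of_nat_Suc)
        also have "fps_deriv (W N ^ (N - s))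
            = of_nat (N - s) * (fps_deriv (W N) * W N ^ (N - Suc s))"
          by (simp add: fps_deriv_power' mult.assoc)
        also have "\<dots> $ l' $ m = of_nat (N - s) * (\<Sum>i=0..l'. \<Sum>j=0..m.
            fps_deriv (W N) $ i $ j * (W N ^ (N - Suc s)) $ (l' - i) $ (m - j))"
          by (simp only: of_nat_fps_mult_nth fps_fps_mult_nth)
        also have "\<dots> = (of_nat (N - s) / of_nat N) * F N"
          using elim by (simp add: F_def sum_distrib_left mult.assoc)
        finally show ?case
          by (metis nonzero_mult_div_cancel_left of_nat_neq_0)
      qed
    qed
  next
    case inner
    define F where "F N = (\<Sum>j=0..m'.
      (of_nat N * fps_deriv (W N $ 0) $ j) * (W N ^ (N - Suc s)) $ 0 $ (m' - j))" for N
    have "(\<lambda>N. (of_nat (N - s) / of_nat N) * F N / of_nat (Suc m')) \<longlonglongrightarrow>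
        1 * (\<Sum>j=0..m'. b $ j * \<Lambda> $ 0 $ (m' - j)) / of_nat (Suc m')"
      unfolding F_def
      by (intro tendsto_intros tendsto_of_nat_diff_ratio W_b less.hyps) (auto simp: inner simp del: of_nat_Suc)
    also have "(\<Sum>j=0..m'. b $ j * \<Lambda> $ 0 $ (m' - j)) = fps_deriv (\<Lambda> $ 0) $ m'"
      by (simp only: \<Lambda>_b fps_mult_nth)
    also have "1 * \<dots> / of_nat (Suc m') = \<Lambda> $ l $ m"
      by (simp only: inner mult_1_left fps_deriv_nth Suc_eq_plus1[symmetric]
          nonzero_mult_div_cancel_left[OF of_nat_neq_0])
    finally show ?thesis
    proof (rule Lim_transform_eventually)
      show "\<forall>\<^sub>F N in sequentially.
          (of_nat (N - s) / of_nat N) * F N / of_nat (Suc m') = (W N ^ (N - s)) $ l $ m"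
        using eventually_gt_at_top[of 0]
      proof eventually_elim
        case (elim N)
        have "of_nat (Suc m') * (W N ^ (N - s)) $ l $ m = fps_deriv ((W N ^ (N - s)) $ 0) $ m'"
          by (simp add: inner del: of_nat_Suc)
        also have "fps_deriv ((W N ^ (N - s)) $ 0)
            = of_nat (N - s) * (fps_deriv (W N $ 0) * (W N ^ (N - Suc s)) $ 0)"
          by (simp add: fps_power_zeroth fps_deriv_power' mult.assoc)
        also have "\<dots> $ m' = of_nat (N - s) * (\<Sum>j=0..m'.
            fps_deriv (W N $ 0) $ j * (W N ^ (N - Suc s)) $ 0 $ (m' - j))"
          unfolding of_nat_fps_mult_nth by (simp only: fps_mult_nth)
        also have "\<dots> = (of_nat (N - s) / of_nat N) * F N"
          using elim by (simp add: F_def sum_distrib_left mult.assoc)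
        finally show ?case
          by (metis nonzero_mult_div_cancel_left of_nat_neq_0)
      qed
    qed
  qed
qed

section \<open>The Gaussian bilinear form\<close>

text \<open>
  These are the moments \<open>E (U ^ l * V ^ m)\<close> of a centered, formally Gaussian pair with
  \<open>E U\<^sup>2 = P\<close>, \<open>E (U * V) = Q\<close> and \<open>E V\<^sup>2 = R\<close>, given by the recursion of Gaussian integration by parts.
  Where a predecessor is taken of \<open>0\<close>, the factor in front of the term vanishes.
\<close>

fun gaussian_form :: "complex \<Rightarrow> complex \<Rightarrow> complex \<Rightarrow> nat \<Rightarrow> nat \<Rightarrow> complex" where
  "gaussian_form P Q R 0 0 = 1"
| "gaussian_form P Q R 0 (Suc m) = R * of_nat m * gaussian_form P Q R 0 (m - 1)"
| "gaussian_form P Q R (Suc l) m = P * of_nat l * gaussian_form P Q R (l - 1) m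
     + Q * of_nat m * gaussian_form P Q R l (m - 1)"

text \<open>
  Integration by parts determines the form.  This is how the matrix of a Gaussian operator is computed.
\<close>

lemma gaussian_formI:
  fixes b :: "nat \<Rightarrow> nat \<Rightarrow> complex"
  assumes "b 0 0 = 1" "\<And>m. b 0 (Suc m) = R * of_nat m * b 0 (m - 1)"
    and "\<And>l m. b (Suc l) m = P * of_nat l * b (l - 1) m + Q * of_nat m * b l (m - 1)"
  shows "b l m = gaussian_form P Q R l m"
proof (induction "l + m" arbitrary: l m rule: less_induct)
  case less
  show ?case
  proof (cases l)
    case l: 0
    show ?thesis
    proof (cases m)
      case (Suc k)
      then show ?thesis using less[of 0 "k - 1"] l by (simp add: assms)
    qed (simp add: l assms)
  next
    case (Suc k)
    then show ?thesis
      using less[of "k - 1" m] less[of k "m - 1"] by (simp add: assms)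
  qed
qed

text \<open>
  The power series \<open>exp (P / 2 * a\<^sup>2 + Q * a * b + R / 2 * b\<^sup>2)\<close>, described by its coefficients; the two
  lemmas on its derivatives are the differential equations of this exponential.
\<close>

definition gaussian_egf :: "complex \<Rightarrow> complex \<Rightarrow> complex \<Rightarrow> complex fps fps" where
  "gaussian_egf P Q R = Abs_fps (\<lambda>l. Abs_fps (\<lambda>m. gaussian_form P Q R l m / (fact l * fact m)))"

lemma gaussian_egf_nth: "gaussian_egf P Q R $ l $ m = gaussian_form P Q R l m / (fact l * fact m)"
  by (simp add: gaussian_egf_def)

lemma fps_deriv_gaussian_egf:
  "fps_deriv (gaussian_egf P Q R)
    = (fps_const (fps_const P) * fps_X + fps_const (fps_const Q * fps_X)) * gaussian_egf P Q R"
proof (intro fps_ext)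
  fix l m
  have "fps_deriv (gaussian_egf P Q R) $ l $ m = gaussian_form P Q R (Suc l) m / (fact l * fact m)"
    by (simp add: fps_deriv_nth_nth gaussian_egf_nth del: fps_deriv_nth of_nat_Suc gaussian_form.simps)
  also have "\<dots> = (P * of_nat l * gaussian_form P Q R (l - 1) m / fact l) / fact m
     + (Q * of_nat m * gaussian_form P Q R l (m - 1) / fact m) / fact l"
    by (simp add: add_divide_distrib mult.commute)
  also have "P * of_nat l * gaussian_form P Q R (l - 1) m / fact l / fact m
      = (fps_const (fps_const P) * (fps_X * gaussian_egf P Q R)) $ l $ m"
    by (cases l) (simp_all add: gaussian_egf_nth del: of_nat_Suc)
  also have "Q * of_nat m * gaussian_form P Q R l (m - 1) / fact m / fact l
      = (fps_const (fps_const Q * fps_X) * gaussian_egf P Q R) $ l $ m"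
    by (cases m) (simp_all add: gaussian_egf_nth mult.assoc del: of_nat_Suc)
  finally show "fps_deriv (gaussian_egf P Q R) $ l $ m
    = ((fps_const (fps_const P) * fps_X + fps_const (fps_const Q * fps_X)) * gaussian_egf P Q R) $ l $ m"
    by (simp only: distrib_right fps_add_nth mult.assoc)
qed

lemma fps_deriv_gaussian_egf_0:
  "fps_deriv (gaussian_egf P Q R $ 0) = (fps_const R * fps_X) * gaussian_egf P Q R $ 0"
proof (rule fps_ext)
  fix m
  have "fps_deriv (gaussian_egf P Q R $ 0) $ m = gaussian_form P Q R 0 (Suc m) / fact m"
    by (simp add: gaussian_egf_nth del: of_nat_Suc gaussian_form.simps)
  also have "\<dots> = ((fps_const R * fps_X) * gaussian_egf P Q R $ 0) $ m"
    by (cases m) (simp_all add: gaussian_egf_nth mult.assoc del: of_nat_Suc)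
  finally show "fps_deriv (gaussian_egf P Q R $ 0) $ m
      = ((fps_const R * fps_X) * gaussian_egf P Q R $ 0) $ m" .
qed

section \<open>Moments of a complex Gaussian weight\<close>

lemma gbinomial_Suc_ratio:
  "a gchoose Suc n = (a gchoose n) * ((a - of_nat n) / of_nat (Suc n))"
  for a :: "'a::field_char_0"
proof -
  have "of_nat (Suc n) * (a gchoose Suc n) = (a gchoose n) * (a - of_nat n)"
    using gbinomial_mult_1[of a n] by (simp add: algebra_simps)
  then show ?thesis
    by (metis nonzero_mult_div_cancel_left of_nat_neq_0 times_divide_eq_right)
qed

text \<open>
  On the left, a coefficient of the series of \<open>exp (- u * x\<^sup>2 / 2)\<close> meets the moment of order \<open>2 * (n + k)\<close> of a
  centered Gaussian of variance \<open>1 / r\<close>.  The equation turns the sum over \<open>n\<close> into a binomial series.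
\<close>

lemma gaussian_binomial_coefficient:
  fixes u r :: complex
  assumes "r \<noteq> 0"
  shows "(- u / 2) ^ n / fact n * (fact (2 * (n + k)) / ((2 * r) ^ (n + k) * fact (n + k)))
    = fact (2 * k) / ((2 * r) ^ k * fact k) * (((- 1 / 2 - of_nat k) gchoose n) * (u / r) ^ n)"
proof (induction n)
  case (Suc n)
  define A where "A = (- u / 2) ^ n / fact n * (fact (2 * (n + k)) / ((2 * r) ^ (n + k) * fact (n + k)))"
  define B where "B = ((- 1 / 2 - of_nat k :: complex) gchoose n) * (u / r) ^ n"
  have two: "2 * (Suc n + k) = Suc (Suc (2 * (n + k)))" by simp
  have fact_two: "(fact (2 * (Suc n + k)) :: complex)
      = of_nat (Suc (Suc (2 * (n + k)))) * (of_nat (Suc (2 * (n + k))) * fact (2 * (n + k)))"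
    by (simp only: two fact_Suc)
  have "(- u / 2) ^ Suc n / fact (Suc n)
      * (fact (2 * (Suc n + k)) / ((2 * r) ^ (Suc n + k) * fact (Suc n + k)))
    = A * (- u / 2 / of_nat (Suc n) * (of_nat (Suc (Suc (2 * (n + k)))) * of_nat (Suc (2 * (n + k)))
        / (2 * r * of_nat (Suc (n + k)))))"
    unfolding fact_two unfolding fact_Suc add_Suc power_Suc A_def
    by (simp only: divide_inverse inverse_mult_distrib mult_ac)
  also have "\<dots> = A * ((- 1 / 2 - of_nat k - of_nat n) / of_nat (Suc n) * (u / r))"
  proof -
    define a where "a = (- 1 / 2 - of_nat k - of_nat n :: complex)"
    have factors: "(of_nat (Suc (Suc (2 * (n + k)))) :: complex) = 2 * of_nat (Suc (n + k))"
      "(of_nat (Suc (2 * (n + k))) :: complex) = - 2 * a"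
      by (simp_all add: a_def algebra_simps)
    show ?thesis
      unfolding factors a_def[symmetric] using of_nat_neq_0[of "n + k", where 'a = complex]
      by (simp del: of_nat_Suc)
  qed
  also have "A = fact (2 * k) / ((2 * r) ^ k * fact k) * B"
    unfolding A_def B_def by (rule Suc.IH)
  also have "fact (2 * k) / ((2 * r) ^ k * fact k) * B
      * ((- 1 / 2 - of_nat k - of_nat n) / of_nat (Suc n) * (u / r))
    = fact (2 * k) / ((2 * r) ^ k * fact k) * (((- 1 / 2 - of_nat k) gchoose (Suc n)) * (u / r) ^ Suc n)"
    by (simp add: B_def gbinomial_Suc_ratio[of _ n] mult_ac del: of_nat_Suc)
  finally show ?case .
qed simp

text \<open>
  A Gaussian of complex parameter \<open>r + u\<close> is expanded around the real Gaussian of parameter \<open>r\<close>.  Integrating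
  the exponential series of \<open>- u * x\<^sup>2 / 2\<close> termwise yields a binomial series in \<open>u / r\<close>.  It converges
  absolutely for \<open>norm u < r\<close>, and its value at \<open>- norm u\<close> provides the domination needed for the interchange.
\<close>

lemma gaussian_series_moment:
  fixes u :: complex and r :: real
  assumes "r > 0" "norm u < r"
  shows "(\<integral>x. normal_density 0 (1 / sqrt r) x *\<^sub>R (exp (- u * of_real x ^ 2 / 2) * of_real x ^ (2 * k)) \<partial>lborel)
    = fact (2 * k) / ((2 * of_real r) ^ k * fact k) * (1 + u / of_real r) powr (- 1 / 2 - of_nat k)"
proof -
  define c where "c v n = (- v / 2) ^ n / fact n" for v :: complex and n
  define p where "p n x = normal_density 0 (1 / sqrt r) x * x ^ (2 * (n + k))" for n x
  define f where "f n x = c u n * complex_of_real (p n x)" for n x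
  define C where "C = (fact (2 * k) / ((2 * of_real r) ^ k * fact k) :: complex)"
  have mom: "has_bochner_integral lborel (p n) (fact (2 * (n + k)) / ((2 * r) ^ (n + k) * fact (n + k)))" for n
    using normal_moment_even[of "1 / sqrt r" 0 "n + k"] assms by (simp add: p_def[abs_def] power_divide)
  have p_nonneg: "p n x \<ge> 0" for n x
    unfolding p_def by (intro mult_nonneg_nonneg zero_le_even_power) simp_all
  have int_p: "integrable lborel (p n)" "(\<integral>x. p n x \<partial>lborel)
      = fact (2 * (n + k)) / ((2 * r) ^ (n + k) * fact (n + k))" for n
    using mom[of n] by (auto simp: has_bochner_integral_iff)
  have coeff: "c v n * of_real (\<integral>x. p n x \<partial>lborel)
      = C * (((- 1 / 2 - of_nat k) gchoose n) * (v / of_real r) ^ n)" for v n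
    using gaussian_binomial_coefficient[of "of_real r" v n k] assms
    by (simp add: int_p c_def C_def)
  have series: "(\<lambda>n. c v n * of_real (\<integral>x. p n x \<partial>lborel)) sums
      (C * (1 + v / of_real r) powr (- 1 / 2 - of_nat k))" if "norm v < r" for v
    unfolding coeff using that assms
    by (intro sums_mult gen_binomial_complex) (simp add: norm_divide)
  have int_f: "integrable lborel (f n)" for n
    using int_p(1)[of n] unfolding f_def by (intro integrable_mult_right integrable_of_real)
  have norm_f: "norm (f n x) = norm u ^ n / 2 ^ n / fact n * p n x" for n x
    using p_nonneg[of n x] by (simp add: f_def c_def norm_mult norm_divide norm_power power_divide)
  have "summable (\<lambda>n. c (- of_real (norm u)) n * of_real (\<integral>x. p n x \<partial>lborel))"
    using series[of "- of_real (norm u)"] assms by (intro sums_summable) simp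
  moreover have "c (- of_real (norm u)) n * of_real (\<integral>x. p n x \<partial>lborel)
      = of_real (\<integral>x. norm (f n x) \<partial>lborel)" for n
    using int_p(1)[of n] by (simp add: norm_f c_def power_divide)
  ultimately have "summable (\<lambda>n. complex_of_real (\<integral>x. norm (f n x) \<partial>lborel))"
    by simp
  then have sum_norm: "summable (\<lambda>n. \<integral>x. norm (f n x) \<partial>lborel)"
    by (simp only: summable_of_real_iff)
  have sums_x: "(\<lambda>n. f n x) sums
      (normal_density 0 (1 / sqrt r) x *\<^sub>R (exp (- u * of_real x ^ 2 / 2) * of_real x ^ (2 * k)))"
    and summable_x: "summable (\<lambda>n. norm (f n x))" for x
  proof -
    define z where "z = - u * of_real x ^ 2 / 2"
    define d where "d = complex_of_real (normal_density 0 (1 / sqrt r) x) * of_real x ^ (2 * k)"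
    have "z = (- u / 2) * of_real x ^ 2" by (simp add: z_def)
    then have "z ^ n = (- u / 2) ^ n * of_real x ^ (2 * n)" for n
      by (simp only: power_mult_distrib power_mult)
    then have f: "f n x = z ^ n /\<^sub>R fact n * d" for n
      by (simp add: f_def c_def p_def d_def power_add distrib_left scaleR_conv_of_real field_simps)
    have "(\<lambda>n. f n x) sums (exp z * d)"
      unfolding f by (intro sums_mult2 exp_converges)
    then show "(\<lambda>n. f n x) sums
      (normal_density 0 (1 / sqrt r) x *\<^sub>R (exp (- u * of_real x ^ 2 / 2) * of_real x ^ (2 * k)))"
      by (simp add: z_def d_def scaleR_conv_of_real mult_ac)
    have "summable (\<lambda>n. norm (z ^ n /\<^sub>R fact n) * norm d)"
      by (intro summable_mult2 summable_norm_exp)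
    then show "summable (\<lambda>n. norm (f n x))"
      unfolding f norm_mult .
  qed
  have "(\<lambda>n. \<integral>x. f n x \<partial>lborel) sums (\<integral>x. (suminf (\<lambda>n. f n x)) \<partial>lborel)"
    by (rule sums_integral[OF int_f _ sum_norm]) (simp add: summable_x)
  moreover have "(\<integral>x. f n x \<partial>lborel) = c u n * of_real (\<integral>x. p n x \<partial>lborel)" for n
    unfolding f_def by simp
  ultimately have "(\<integral>x. (suminf (\<lambda>n. f n x)) \<partial>lborel) = C * (1 + u / of_real r) powr (- 1 / 2 - of_nat k)"
    using series[OF assms(2)] by (simp add: sums_unique2)
  then show ?thesis
    by (simp only: sums_unique[OF sums_x, symmetric] C_def)
qed

text \<open>
  The function by which the operator \<open>M_op \<tau>\<close> multiplies.
\<close>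

definition gaussian_weight :: "complex \<Rightarrow> real \<Rightarrow> complex" where
  "gaussian_weight \<tau> x = csqrt (1 + \<tau>) * exp (- \<tau> * of_real x ^ 2 / 2)"

lemma gaussian_weight_measurable [measurable]: "gaussian_weight \<tau> \<in> borel_measurable borel"
  unfolding gaussian_weight_def by (intro borel_measurable_continuous_onI continuous_intros) auto

lemma integrable_gaussian_weight_power:
  assumes "Re \<tau> > - 1"
  shows "integrable std_normal_distribution (\<lambda>x. gaussian_weight \<tau> x * of_real x ^ j)"
proof -
  define r where "r = 1 + Re \<tau>"
  have r: "r > 0" using assms by (simp add: r_def)
  have dens: "std_normal_density x * exp (- Re \<tau> * x\<^sup>2 / 2)
      = normal_density 0 (1 / sqrt r) x / sqrt r" for x
  proof -
    have "exp (- x\<^sup>2 / 2) * exp (- Re \<tau> * x\<^sup>2 / 2) = exp (- (x\<^sup>2 * r / 2))"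
      unfolding exp_add[symmetric] r_def by (simp add: field_simps)
    then show ?thesis
      using r by (simp add: normal_density_def power_divide real_sqrt_divide real_sqrt_mult)
  qed
  have "integrable lborel (\<lambda>x. std_normal_density x *\<^sub>R (gaussian_weight \<tau> x * of_real x ^ j))"
  proof (rule Bochner_Integration.integrable_bound)
    show "integrable lborel (\<lambda>x. norm (csqrt (1 + \<tau>)) / sqrt r * (normal_density 0 (1 / sqrt r) x * \<bar>x\<bar> ^ j))"
      using integrable_normal_moment_abs[of "1 / sqrt r" 0 j] r by simp
    show "AE x in lborel. norm (std_normal_density x *\<^sub>R (gaussian_weight \<tau> x * of_real x ^ j))
      \<le> norm (norm (csqrt (1 + \<tau>)) / sqrt r * (normal_density 0 (1 / sqrt r) x * \<bar>x\<bar> ^ j))"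
    proof (intro AE_I2)
      fix x :: real
      have "norm (std_normal_density x *\<^sub>R (gaussian_weight \<tau> x * of_real x ^ j))
        = norm (csqrt (1 + \<tau>)) * (std_normal_density x * exp (- Re \<tau> * x\<^sup>2 / 2)) * \<bar>x\<bar> ^ j"
        by (simp add: gaussian_weight_def norm_mult norm_power power_abs flip: of_real_power)
      then show "norm (std_normal_density x *\<^sub>R (gaussian_weight \<tau> x * of_real x ^ j))
        \<le> norm (norm (csqrt (1 + \<tau>)) / sqrt r * (normal_density 0 (1 / sqrt r) x * \<bar>x\<bar> ^ j))"
        using r unfolding dens by simp
    qed
  qed simp
  then show ?thesis
    by (subst integrable_density) auto
qed

lemma gaussian_weight_odd_moment:
  assumes "odd j"
  shows "(\<integral>x. gaussian_weight \<tau> x * of_real x ^ j \<partial>std_normal_distribution) = 0"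
proof -
  define f where "f x = std_normal_density x *\<^sub>R (gaussian_weight \<tau> x * of_real x ^ j)" for x
  have "f (- x) = - f x" for x
    using assms by (simp add: f_def gaussian_weight_def normal_density_def)
  then have "(\<integral>x. f x \<partial>lborel) = - (\<integral>x. f x \<partial>lborel)"
    using lborel_integral_real_affine[of "-1" f 0] by simp
  then have "(\<integral>x. f x \<partial>lborel) = 0" by simp
  then show ?thesis
    unfolding f_def by (subst integral_density) auto
qed

text \<open>
  Every \<open>s = 1 + \<tau>\<close> with positive real part lies in the disc of radius \<open>r\<close> around \<open>r\<close> once the real
  number \<open>r\<close> is large enough.  So one series expansion reaches every admissible \<open>\<tau>\<close>.
  The principal branch of the square root is the right one because the binomial series sums to a principal power.
\<close>

lemma gaussian_weight_even_moment:
  assumes "Re \<tau> > - 1"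
  shows "(\<integral>x. gaussian_weight \<tau> x * of_real x ^ (2 * k) \<partial>std_normal_distribution)
    = fact (2 * k) / (2 ^ k * fact k) / (1 + \<tau>) ^ k"
proof -
  define s where "s = 1 + \<tau>"
  \<comment> \<open>This choice makes \<open>(norm (s - r))\<^sup>2\<close> equal to \<open>r\<^sup>2 - (norm s)\<^sup>2\<close>.\<close>
  define r where "r = (norm s)\<^sup>2 / Re s"
  define z where "z = s / of_real r"
  have s: "Re s > 0" "s \<noteq> 0" using assms by (auto simp: s_def complex_eq_iff)
  then have r: "r > 0" by (simp add: r_def)
  then have z: "z \<noteq> 0" "s = of_real r * z" using s by (simp_all add: z_def)
  have "(norm (s - of_real r))\<^sup>2 = (norm s)\<^sup>2 - 2 * r * Re s + r\<^sup>2"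
    unfolding cmod_power2 by (simp add: power2_eq_square algebra_simps)
  also have "\<dots> = r\<^sup>2 - (norm s)\<^sup>2"
    using s by (simp add: r_def)
  also have "\<dots> < r\<^sup>2" using s by simp
  finally have u: "norm (s - of_real r) < r"
    using r by (intro power2_less_imp_less[of _ r]) auto
  have dens: "std_normal_density x *\<^sub>R (gaussian_weight \<tau> x * of_real x ^ (2 * k))
      = (csqrt s / of_real (sqrt r)) * (normal_density 0 (1 / sqrt r) x *\<^sub>R
          (exp (- (s - of_real r) * of_real x ^ 2 / 2) * of_real x ^ (2 * k)))" for x
  proof -
    have "complex_of_real (exp (- x\<^sup>2 / 2)) * exp (- \<tau> * of_real x ^ 2 / 2)
        = of_real (exp (- x\<^sup>2 * r / 2)) * exp (- (s - of_real r) * of_real x ^ 2 / 2)"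
      unfolding exp_of_real[symmetric] exp_add[symmetric] s_def
      by (rule arg_cong[of _ _ exp]) (simp add: field_simps)
    then show ?thesis
      using r by (simp add: normal_density_def power_divide real_sqrt_divide real_sqrt_mult
          scaleR_conv_of_real gaussian_weight_def s_def mult_ac)
  qed
  have "(\<integral>x. gaussian_weight \<tau> x * of_real x ^ (2 * k) \<partial>std_normal_distribution)
     = (\<integral>x. std_normal_density x *\<^sub>R (gaussian_weight \<tau> x * of_real x ^ (2 * k)) \<partial>lborel)"
    by (subst integral_density) auto
  also have "\<dots> = (csqrt s / of_real (sqrt r)) *
      (fact (2 * k) / ((2 * of_real r) ^ k * fact k) * (1 + (s - of_real r) / of_real r) powr (- 1 / 2 - of_nat k))"
    by (simp only: dens integral_mult_right_zero gaussian_series_moment[OF r u])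
  also have "1 + (s - of_real r) / of_real r = z"
    using r by (simp add: z_def field_simps)
  also have "csqrt s / of_real (sqrt r) = z powr (1 / 2)"
  proof -
    have "csqrt s = of_real r powr (1 / 2) * z powr (1 / 2)"
      unfolding csqrt_conv_powr z(2) using r by (intro powr_times_real_left) auto
    also have "complex_of_real r powr (1 / 2) = of_real (sqrt r)"
      using r by (simp add: csqrt_conv_powr[symmetric])
    finally show ?thesis using r by simp
  qed
  also have "z powr (1 / 2) * (fact (2 * k) / ((2 * of_real r) ^ k * fact k) * z powr (- 1 / 2 - of_nat k))
      = fact (2 * k) / ((2 * of_real r) ^ k * fact k) * (z powr (1 / 2) * z powr (- 1 / 2 - of_nat k))"
    by simp
  also have "z powr (1 / 2) * z powr (- 1 / 2 - of_nat k) = z powr (- of_nat k)"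
    by (subst powr_add[symmetric]) simp
  also have "\<dots> = 1 / z ^ k"
    using z by (simp add: powr_minus powr_nat' inverse_eq_divide)
  finally show ?thesis
    using r z unfolding s_def[symmetric] by (simp add: z(2) power_mult_distrib)
qed

section \<open>Hermite multipliers composed with dilations\<close>

lemma poly_induct_monom [case_names monom add]:
  fixes p :: "'a::comm_semiring_1 poly"
  assumes monom: "\<And>c n. Q (monom c n)" and add: "\<And>p q. Q p \<Longrightarrow> Q q \<Longrightarrow> Q (p + q)"
  shows "Q p"
proof -
  have "Q (\<Sum>i\<le>n. monom (coeff p i) i)" for n
    by (induction n) (auto intro: monom add)
  then show ?thesis
    by (metis poly_as_sum_of_monoms)
qed

lemma hermite_induct [case_names hermite add smult]:
  assumes hermite: "\<And>l. Q (hermite l)" and add: "\<And>p q. Q p \<Longrightarrow> Q q \<Longrightarrow> Q (p + q)"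
    and smult: "\<And>c p. Q p \<Longrightarrow> Q (smult c p)"
  shows "Q p"
proof (induction "degree p" arbitrary: p rule: less_induct)
  case less
  define n where "n = degree p"
  define g where "g = p - smult (coeff p n) (hermite n)"
  have p: "p = g + smult (coeff p n) (hermite n)" by (simp add: g_def)
  have "Q 0" using smult[OF hermite, of 0] by simp
  have "degree g \<le> n"
    unfolding g_def using degree_hermite[of n] degree_smult_le[of "coeff p n" "hermite n"]
    by (intro degree_diff_le) (auto simp: n_def)
  moreover have "coeff g n = 0" by (simp add: g_def lead_coeff_hermite)
  ultimately have "g = 0 \<or> degree g < n"
    by (metis le_neq_implies_less leading_coeff_0_iff)
  then have "Q g" using less \<open>Q 0\<close> n_def by blast
  then show ?case by (subst p) (intro add smult hermite)
qed

lemma T_op_add: "T_op \<omega> (f + g) = T_op \<omega> f + T_op \<omega> g"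
  and T_op_smult: "T_op \<omega> (smult c f) = smult c (T_op \<omega> f)"
  and T_op_hermite: "T_op \<omega> (hermite l) = smult (\<omega> ^ l) (hermite l)"
  using is_hermite_multiplier_T_op[of \<omega>] unfolding is_hermite_multiplier_def by blast+

lemma T_op_zero: "T_op \<omega> 0 = 0"
  using T_op_smult[of \<omega> 0 0] by simp

lemma T_op_one: "T_op \<omega> 1 = 1"
  using T_op_hermite[of \<omega> 0] by simp

lemma X_mult_hermite: "[:0, 1:] * hermite l = hermite (Suc l) + smult (of_nat l) (hermite (l - 1))"
  by (simp only: hermite_rec) simp

text \<open>
  The commutation relations of \<open>T_op \<omega>\<close> with differentiation and with multiplication by \<open>x\<close> hold on Hermite
  polynomials by their derivative rule and three-term recurrence, hence everywhere by linearity.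
\<close>

lemma pderiv_T_op: "pderiv (T_op \<omega> f) = smult \<omega> (T_op \<omega> (pderiv f))"
proof (induction f rule: hermite_induct)
  case (hermite l)
  show ?case
    by (cases l) (simp_all add: T_op_zero T_op_hermite pderiv_hermite pderiv_smult T_op_smult mult_ac del: hermite.simps of_nat_Suc)
qed (simp_all add: T_op_add T_op_smult pderiv_add pderiv_smult smult_add_right mult_ac)

lemma T_op_X_mult:
  "T_op \<omega> ([:0, 1:] * f) = smult \<omega> ([:0, 1:] * T_op \<omega> f) + smult (1 - \<omega>\<^sup>2) (T_op \<omega> (pderiv f))"
proof (induction f rule: hermite_induct)
  case (hermite l)
  have pow: "\<omega> ^ Suc l * of_nat l = \<omega>\<^sup>2 * (\<omega> ^ (l - 1) * of_nat l)"
    by (cases l) (simp_all add: power2_eq_square)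
  have "T_op \<omega> ([:0, 1:] * hermite l)
      = smult (\<omega> ^ Suc l) (hermite (Suc l)) + smult (\<omega> ^ (l - 1) * of_nat l) (hermite (l - 1))"
    by (simp only: X_mult_hermite T_op_add T_op_smult T_op_hermite smult_smult) (simp only: mult.commute)
  also have "\<dots> = smult (\<omega> ^ Suc l) (hermite (Suc l) + smult (of_nat l) (hermite (l - 1)))
      + smult ((1 - \<omega>\<^sup>2) * (\<omega> ^ (l - 1) * of_nat l)) (hermite (l - 1))"
    unfolding smult_add_right smult_smult pow add.assoc smult_add_left[symmetric]
    by (simp only: left_diff_distrib mult_1_left) simp
  also have "\<dots> = smult \<omega> ([:0, 1:] * T_op \<omega> (hermite l)) + smult (1 - \<omega>\<^sup>2) (T_op \<omega> (pderiv (hermite l)))"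
    by (simp only: pderiv_hermite T_op_smult T_op_hermite mult_smult_right smult_smult X_mult_hermite)
       (simp only: power_Suc mult_ac)
  finally show ?case .
next
  case (add p q)
  show ?case
    by (simp only: distrib_left T_op_add add pderiv_add smult_add_right add_ac)
next
  case (smult c p)
  show ?case
    by (simp only: mult_smult_right T_op_smult smult pderiv_smult smult_add_right smult_smult)
       (simp only: mult.commute)
qed

text \<open>
  The polynomial part of a centered Gaussian operator.
\<close>

definition TS_op :: "complex \<Rightarrow> complex \<Rightarrow> complex poly \<Rightarrow> complex poly" where
  "TS_op \<omega> c f = T_op \<omega> (S_op c f)"

lemma S_op_add: "S_op c (f + g) = S_op c f + S_op c g"
  and S_op_smult: "S_op c (smult a f) = smult a (S_op c f)"
  by (simp_all add: S_op_def pcompose_add pcompose_smult)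

lemma TS_op_add: "TS_op \<omega> c (f + g) = TS_op \<omega> c f + TS_op \<omega> c g"
  and TS_op_smult: "TS_op \<omega> c (smult a f) = smult a (TS_op \<omega> c f)"
  and TS_op_one: "TS_op \<omega> c 1 = 1"
  by (simp_all add: TS_op_def S_op_add S_op_smult T_op_add T_op_smult)
     (simp add: S_op_def pcompose_1 T_op_one)

lemma pderiv_S_op: "pderiv (S_op c f) = smult c (S_op c (pderiv f))"
  by (simp add: S_op_def pderiv_pcompose pderiv_pCons)

lemma pderiv_TS_op: "pderiv (TS_op \<omega> c f) = smult (c * \<omega>) (TS_op \<omega> c (pderiv f))"
  by (simp add: TS_op_def pderiv_T_op pderiv_S_op T_op_smult mult.commute)

text \<open>
  Only \<open>c * \<omega>\<close> and \<open>c\<^sup>2\<close> occur on the right-hand side, so these two numbers determine the operator.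
\<close>

lemma TS_op_X_mult:
  "TS_op \<omega> c ([:0, 1:] * f)
    = smult (c * \<omega>) ([:0, 1:] * TS_op \<omega> c f) + smult (c\<^sup>2 - (c * \<omega>)\<^sup>2) (TS_op \<omega> c (pderiv f))"
proof -
  have X: "S_op c ([:0, 1:] * f) = smult c ([:0, 1:] * S_op c f)"
    by (simp only: S_op_def pcompose_mult pcompose_idR) (simp add: pcompose_pCons)
  have "TS_op \<omega> c ([:0, 1:] * f) = smult c (smult \<omega> ([:0, 1:] * TS_op \<omega> c f)
      + smult (1 - \<omega>\<^sup>2) (smult c (TS_op \<omega> c (pderiv f))))"
    by (simp only: TS_op_def X T_op_smult T_op_X_mult pderiv_S_op)
  also have "\<dots> = smult (c * \<omega>) ([:0, 1:] * TS_op \<omega> c f)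
      + smult (c * ((1 - \<omega>\<^sup>2) * c)) (TS_op \<omega> c (pderiv f))"
    by (simp only: smult_add_right smult_smult mult.assoc)
  also have "c * ((1 - \<omega>\<^sup>2) * c) = c\<^sup>2 - (c * \<omega>)\<^sup>2"
    by (simp add: power2_eq_square algebra_simps)
  finally show ?thesis .
qed

lemma monom_Suc_X: "monom 1 (Suc n) = [:0, 1:] * (monom 1 n :: 'a::comm_semiring_1 poly)"
  by (simp add: monom_Suc)

text \<open>
  The ambiguity in the representation: one may change the signs of both \<open>c\<close> and \<open>\<omega>\<close>, and \<open>\<omega>\<close> is
  arbitrary if \<open>c = 0\<close>.
\<close>

lemma TS_op_eqI:
  assumes "c\<^sup>2 = c'\<^sup>2" "c * \<omega> = c' * \<omega>'"
  shows "TS_op \<omega> c = TS_op \<omega>' c'"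
proof
  fix f
  have mon: "TS_op \<omega> c (monom 1 n) = TS_op \<omega>' c' (monom 1 n)" for n
  proof (induction n rule: less_induct)
    case (less n)
    show ?case
    proof (cases n)
      case 0
      have "(monom 1 n :: complex poly) = 1" by (simp add: 0 monom_0 one_pCons)
      then show ?thesis by (simp only: TS_op_one)
    next
      case (Suc k)
      have deriv: "(pderiv (monom 1 k) :: complex poly) = smult (of_nat k) (monom 1 (k - 1))"
        by (simp add: pderiv_monom smult_monom)
      have "TS_op \<omega> c (monom 1 k) = TS_op \<omega>' c' (monom 1 k)"
        and "TS_op \<omega> c (monom 1 (k - 1)) = TS_op \<omega>' c' (monom 1 (k - 1))"
        using less.IH[of k] less.IH[of "k - 1"] Suc by auto
      then show ?thesis
        unfolding Suc monom_Suc_X TS_op_X_mult deriv TS_op_smult assms by simp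
    qed
  qed
  show "TS_op \<omega> c f = TS_op \<omega>' c' f"
  proof (induction f rule: poly_induct_monom)
    case (monom a n)
    have "monom a n = smult a (monom 1 n)" by (simp add: smult_monom)
    then show ?case by (simp only: TS_op_smult mon)
  qed (simp add: TS_op_add)
qed

section \<open>The bilinear form of a centered Gaussian operator\<close>

definition gaussian_functional :: "complex \<Rightarrow> complex poly \<Rightarrow> complex" where
  "gaussian_functional \<tau> p
    = (\<integral>x. gaussian_weight \<tau> x * poly p (of_real x) \<partial>std_normal_distribution)"

lemma integrable_gaussian_weight_poly:
  assumes "Re \<tau> > - 1"
  shows "integrable std_normal_distribution (\<lambda>x. gaussian_weight \<tau> x * poly p (of_real x))"
proof -
  have "integrable std_normal_distribution
      (\<lambda>x. \<Sum>i\<le>degree p. coeff p i * (gaussian_weight \<tau> x * of_real x ^ i))"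
    using assms
    by (intro Bochner_Integration.integrable_sum integrable_mult_right integrable_gaussian_weight_power)
  then show ?thesis
    by (simp add: poly_altdef sum_distrib_left mult_ac)
qed

context
  fixes \<tau> :: complex
  assumes \<tau>: "Re \<tau> > - 1"
begin

lemma gaussian_functional_add:
  "gaussian_functional \<tau> (p + q) = gaussian_functional \<tau> p + gaussian_functional \<tau> q"
  unfolding gaussian_functional_def poly_add distrib_left
  by (intro Bochner_Integration.integral_add integrable_gaussian_weight_poly \<tau>)

lemma gaussian_functional_smult:
  "gaussian_functional \<tau> (smult a p) = a * gaussian_functional \<tau> p"
  unfolding gaussian_functional_def poly_smult
  by (simp only: mult.left_commute[of _ a] integral_mult_right_zero)

lemma gaussian_functional_monom:
  "gaussian_functional \<tau> (monom 1 j)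
    = (if even j then fact j / (2 ^ (j div 2) * fact (j div 2)) / (1 + \<tau>) ^ (j div 2) else 0)"
  using gaussian_weight_odd_moment[of j \<tau>] gaussian_weight_even_moment[OF \<tau>, of "j div 2"]
  by (auto simp: gaussian_functional_def poly_monom)

lemma gaussian_functional_one: "gaussian_functional \<tau> 1 = 1"
  using gaussian_functional_monom[of 0] by (simp add: monom_0 one_pCons)

text \<open>
  Integration by parts for the complex Gaussian weight, read off from the moments.
\<close>

lemma gaussian_functional_X_mult:
  "gaussian_functional \<tau> ([:0, 1:] * p) = gaussian_functional \<tau> (pderiv p) / (1 + \<tau>)"
proof (induction p rule: poly_induct_monom)
  case (monom c n)
  have nz: "1 + \<tau> \<noteq> 0" using \<tau> by (auto simp: complex_eq_iff)
  have step: "gaussian_functional \<tau> (monom 1 (Suc n))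
      = of_nat n * gaussian_functional \<tau> (monom 1 (n - 1)) / (1 + \<tau>)"
  proof (cases "odd n")
    case True
    then obtain k where n: "n = 2 * k + 1" by (elim oddE)
    have "(fact (Suc (2 * k + 1)) :: complex) = 2 * of_nat (Suc k) * of_nat (2 * k + 1) * fact (2 * k)"
      by (simp add: algebra_simps)
    then show ?thesis
      using nz of_nat_neq_0[of k, where 'a = complex]
      by (simp add: gaussian_functional_monom n fact_Suc[of k] del: fact_Suc of_nat_Suc)
  qed (simp add: gaussian_functional_monom)
  have "[:0, 1:] * monom c n = smult c (monom 1 (Suc n))"
    by (simp add: monom_Suc[symmetric] smult_monom)
  moreover have "pderiv (monom c n) = smult c (smult (of_nat n) (monom 1 (n - 1)))"
    by (simp add: pderiv_monom smult_monom mult_ac)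
  ultimately show ?case
    by (simp only: gaussian_functional_smult step) simp
next
  case (add p q)
  show ?case
    by (simp only: distrib_left gaussian_functional_add add pderiv_add add_divide_distrib)
qed

text \<open>
  Multiplication by \<open>x\<close> in the first argument is moved through the operator and then removed by integration
  by parts.  This is the recursion of a Gaussian form with the parameters shown.
\<close>

lemma gaussian_functional_TS_op:
  assumes P: "P = c\<^sup>2 - \<tau> / (1 + \<tau>) * (c * \<omega>)\<^sup>2" and Q: "Q = c * \<omega> / (1 + \<tau>)"
    and R: "R = 1 / (1 + \<tau>)"
  shows "gaussian_functional \<tau> (TS_op \<omega> c (monom 1 l) * monom 1 m) = gaussian_form P Q R l m"
proof (rule gaussian_formI[where b = "\<lambda>l m. gaussian_functional \<tau> (TS_op \<omega> c (monom 1 l) * monom 1 m)"])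
  have deriv: "(pderiv (monom 1 k) :: complex poly) = smult (of_nat k) (monom 1 (k - 1))" for k
    by (simp add: pderiv_monom smult_monom)
  have one: "TS_op \<omega> c (monom 1 0) = 1"
    by (simp add: TS_op_one monom_0 flip: one_pCons)
  show "gaussian_functional \<tau> (TS_op \<omega> c (monom 1 0) * monom 1 0) = 1"
    unfolding one by (simp add: monom_0 gaussian_functional_one flip: one_pCons)
  show "gaussian_functional \<tau> (TS_op \<omega> c (monom 1 0) * monom 1 (Suc m))
      = R * of_nat m * gaussian_functional \<tau> (TS_op \<omega> c (monom 1 0) * monom 1 (m - 1))" for m
    unfolding one mult_1_left monom_Suc_X gaussian_functional_X_mult deriv gaussian_functional_smult R
    by simp
  show "gaussian_functional \<tau> (TS_op \<omega> c (monom 1 (Suc l)) * monom 1 m)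
      = P * of_nat l * gaussian_functional \<tau> (TS_op \<omega> c (monom 1 (l - 1)) * monom 1 m)
        + Q * of_nat m * gaussian_functional \<tau> (TS_op \<omega> c (monom 1 l) * monom 1 (m - 1))" for l m
  proof -
    define u where "u = TS_op \<omega> c (monom 1 l)"
    define v where "v = TS_op \<omega> c (monom 1 (l - 1))"
    define \<sigma> where "\<sigma> = inverse (1 + \<tau>)"
    have "1 + \<tau> \<noteq> 0" using \<tau> by (auto simp: complex_eq_iff)
    then have \<sigma>: "\<tau> * \<sigma> = 1 - \<sigma>" by (simp add: \<sigma>_def field_simps)
    have "TS_op \<omega> c (monom 1 (Suc l)) * monom 1 m
        = smult (c * \<omega>) ([:0, 1:] * (u * monom 1 m))
          + smult ((c\<^sup>2 - (c * \<omega>)\<^sup>2) * of_nat l) (v * monom 1 m)"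
      by (simp only: monom_Suc_X TS_op_X_mult deriv TS_op_smult u_def v_def distrib_right
          mult_smult_left smult_smult mult.assoc)
    then have "gaussian_functional \<tau> (TS_op \<omega> c (monom 1 (Suc l)) * monom 1 m)
        = c * \<omega> * (gaussian_functional \<tau> (pderiv (u * monom 1 m)) / (1 + \<tau>))
          + (c\<^sup>2 - (c * \<omega>)\<^sup>2) * of_nat l * gaussian_functional \<tau> (v * monom 1 m)"
      by (simp only: gaussian_functional_add gaussian_functional_smult gaussian_functional_X_mult)
    also have "pderiv (u * monom 1 m)
        = smult (of_nat m) (u * monom 1 (m - 1)) + smult (c * \<omega> * of_nat l) (v * monom 1 m)"
      by (simp only: pderiv_mult deriv u_def v_def pderiv_TS_op TS_op_smult mult_smult_left
          mult_smult_right smult_smult mult.commute add.commute)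
    also have "c * \<omega> * (gaussian_functional \<tau> (smult (of_nat m) (u * monom 1 (m - 1))
            + smult (c * \<omega> * of_nat l) (v * monom 1 m)) / (1 + \<tau>))
          + (c\<^sup>2 - (c * \<omega>)\<^sup>2) * of_nat l * gaussian_functional \<tau> (v * monom 1 m)
        = P * of_nat l * gaussian_functional \<tau> (v * monom 1 m)
          + Q * of_nat m * gaussian_functional \<tau> (u * monom 1 (m - 1))"
      unfolding gaussian_functional_add gaussian_functional_smult P Q divide_inverse
        \<sigma>_def[symmetric] \<sigma>
      by (simp add: algebra_simps power2_eq_square)
    finally show ?thesis unfolding u_def v_def .
  qed
qed

end

section \<open>The mixed moments of a tensor power\<close>

lemma standardizedD:
  assumes "standardized \<alpha>"
  shows "prob_space \<alpha>" "sets \<alpha> = sets borel" "\<And>n. integrable \<alpha> (\<lambda>x. x ^ n)"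
  using assms by (auto simp: standardized_def)

text \<open>
  Hoelder's inequality in a crude form that suffices for integrability: \<open>u * v\<close> is at most \<open>u powr q\<close> if
  \<open>v \<le> u powr (q - 1)\<close>, and at most \<open>v\<close> to the conjugate exponent otherwise.  That exponent is rounded up to an
  even integer, so that the bound becomes a moment.
\<close>

lemma integrable_Lq_mult_power:
  fixes F :: "real \<Rightarrow> complex"
  assumes \<alpha>: "standardized \<alpha>" and q: "q > 1" and F: "F \<in> borel_measurable \<alpha>"
    and Fq: "integrable \<alpha> (\<lambda>x. norm (F x) powr q)"
  shows "integrable \<alpha> (\<lambda>x. F x * of_real x ^ j)"
proof -
  interpret prob_space \<alpha> using standardizedD(1)[OF \<alpha>] .
  note [measurable_cong] = standardizedD(2)[OF \<alpha>]
  note [measurable] = F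
  obtain n :: nat where n: "real (2 * n) \<ge> q / (q - 1)"
    using real_arch_simple[of "q / (q - 1)"] by (metis le_add_same_cancel1 mult_2 of_nat_add of_nat_0_le_iff order_trans)
  show ?thesis
  proof (rule Bochner_Integration.integrable_bound)
    show "integrable \<alpha> (\<lambda>x. norm (F x) powr q + (1 + x ^ (j * (2 * n))))"
      using Fq standardizedD(3)[OF \<alpha>] by simp
    show "AE x in \<alpha>. norm (F x * of_real x ^ j) \<le> norm (norm (F x) powr q + (1 + x ^ (j * (2 * n))))"
    proof (intro AE_I2)
      fix x
      define u where "u = norm (F x)"
      define v where "v = \<bar>x\<bar> ^ j"
      have uv: "u \<ge> 0" "v \<ge> 0" by (simp_all add: u_def v_def)
      have v_pow: "v ^ (2 * n) = x ^ (j * (2 * n))"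
        by (simp add: v_def power_even_abs flip: power_mult)
      have "u * v \<le> u powr q + (1 + v ^ (2 * n))"
      proof (cases "v \<le> u powr (q - 1)")
        case True
        then have "u * v \<le> u * u powr (q - 1)" using uv by (intro mult_left_mono) auto
        also have "\<dots> = u powr q" using uv by (simp add: powr_mult_base)
        finally show ?thesis using uv by (intro add_increasing2) simp_all
      next
        case False
        then have v: "v > 0" "u powr (q - 1) < v" using uv by (auto simp: not_le intro: le_less_trans[rotated])
        have "u = (u powr (q - 1)) powr (1 / (q - 1))"
          using q uv by (simp add: powr_powr)
        also have "\<dots> \<le> v powr (1 / (q - 1))"
          using v q by (intro powr_mono2) auto
        finally have "u * v \<le> v powr (1 / (q - 1)) * v" using uv by (intro mult_right_mono)
        also have "\<dots> = v powr (q / (q - 1))"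
        proof -
          have "1 + 1 / (q - 1) = q / (q - 1)" using q by (simp add: field_simps)
          then show ?thesis using powr_mult_base[of v "1 / (q - 1)"] uv by (simp add: mult.commute)
        qed
        also have "\<dots> \<le> 1 + v ^ (2 * n)"
        proof (cases "v \<le> 1")
          case True
          then have "v powr (q / (q - 1)) \<le> 1" using q v by (intro powr_le1) auto
          then show ?thesis using uv by (intro add_increasing2) simp_all
        next
          case False
          then have "v powr (q / (q - 1)) \<le> v powr real (2 * n)" using n by (intro powr_mono) auto
          also have "\<dots> = v ^ (2 * n)" using v by (intro powr_realpow)
          finally show ?thesis by simp
        qed
        finally show ?thesis by (rule add_increasing[rotated]) simp
      qed
      then have "u * v \<le> u powr q + (1 + x ^ (j * (2 * n)))" unfolding v_pow .
      then show "norm (F x * of_real x ^ j) \<le> norm (norm (F x) powr q + (1 + x ^ (j * (2 * n))))"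
        by (simp add: norm_mult norm_power u_def v_def)
    qed
  qed simp
qed

definition mixed_moment :: "real measure \<Rightarrow> (complex poly \<Rightarrow> real \<Rightarrow> complex) \<Rightarrow> nat \<Rightarrow> nat \<Rightarrow> complex" where
  "mixed_moment \<alpha> K k j = (\<integral>x. K (monom 1 k) x * of_real x ^ j \<partial>\<alpha>)"

lemma hermite_low: "hermite 0 = monom 1 0" "hermite 1 = monom 1 1" "hermite 2 = monom 1 2 + smult (- 1) (monom 1 0)"
  by (simp_all add: numeral_2_eq_2 monom_Suc monom_0 one_pCons)

context
  fixes \<alpha> :: "real measure" and q :: real and K :: "complex poly \<Rightarrow> real \<Rightarrow> complex"
  assumes \<alpha>: "standardized \<alpha>" and q: "q > 1" and K: "linear_into_Lq \<alpha> q K"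
begin

lemma K_measurable: "K f \<in> borel_measurable borel"
  using K standardizedD(2)[OF \<alpha>] unfolding linear_into_Lq_def
  by (metis measurable_cong_sets)

lemma integrable_K_power: "integrable \<alpha> (\<lambda>x. K f x * of_real x ^ j)"
  using K by (intro integrable_Lq_mult_power[OF \<alpha> q]) (auto simp: linear_into_Lq_def)

lemma matrix_coeff_low:
  "matrix_coeff \<alpha> K 0 0 = mixed_moment \<alpha> K 0 0"
  "matrix_coeff \<alpha> K 1 0 = mixed_moment \<alpha> K 1 0"
  "matrix_coeff \<alpha> K 0 1 = mixed_moment \<alpha> K 0 1"
  "matrix_coeff \<alpha> K 1 1 = mixed_moment \<alpha> K 1 1"
  "matrix_coeff \<alpha> K 0 2 = mixed_moment \<alpha> K 0 2 - mixed_moment \<alpha> K 0 0"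
  "matrix_coeff \<alpha> K 2 0 = mixed_moment \<alpha> K 2 0 - mixed_moment \<alpha> K 0 0"
proof -
  show "matrix_coeff \<alpha> K 0 0 = mixed_moment \<alpha> K 0 0"
    "matrix_coeff \<alpha> K 1 0 = mixed_moment \<alpha> K 1 0"
    "matrix_coeff \<alpha> K 0 1 = mixed_moment \<alpha> K 0 1"
    "matrix_coeff \<alpha> K 1 1 = mixed_moment \<alpha> K 1 1"
    by (simp_all only: matrix_coeff_def mixed_moment_def hermite_low poly_monom mult_1_left)
  show "matrix_coeff \<alpha> K 0 2 = mixed_moment \<alpha> K 0 2 - mixed_moment \<alpha> K 0 0"
    using integrable_K_power[of "monom 1 0" 2] integrable_K_power[of "monom 1 0" 0]
    by (simp add: matrix_coeff_def mixed_moment_def hermite_low poly_monom algebra_simps)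
  have "AE x in \<alpha>. K (hermite 2) x = K (monom 1 2) x + K (smult (- 1) (monom 1 0)) x"
    and "AE x in \<alpha>. K (smult (- 1) (monom 1 0)) x = - 1 * K (monom 1 0) x"
    using K unfolding linear_into_Lq_def hermite_low by blast+
  then have "AE x in \<alpha>. K (hermite 2) x = K (monom 1 2) x - K (monom 1 0) x"
    by eventually_elim simp
  then have "(\<integral>x. K (hermite 2) x \<partial>\<alpha>) = (\<integral>x. K (monom 1 2) x - K (monom 1 0) x \<partial>\<alpha>)"
    using K by (intro integral_cong_AE borel_measurable_diff) (auto simp: linear_into_Lq_def)
  also have "\<dots> = (\<integral>x. K (monom 1 2) x \<partial>\<alpha>) - (\<integral>x. K (monom 1 0) x \<partial>\<alpha>)"
    using integrable_K_power[of "monom 1 2" 0] integrable_K_power[of "monom 1 0" 0] by simp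
  finally show "matrix_coeff \<alpha> K 2 0 = mixed_moment \<alpha> K 2 0 - mixed_moment \<alpha> K 0 0"
    by (simp add: matrix_coeff_def mixed_moment_def)
qed

end

lemma powr_neg_half: "N > 0 \<Longrightarrow> real N powr (- real k / 2) = (1 / sqrt (real N)) ^ k"
proof -
  assume "N > 0"
  then have "(1 / sqrt (real N)) ^ k = (real N powr (- 1 / 2)) powr real k"
    by (simp add: powr_minus powr_half_sqrt inverse_eq_divide powr_realpow)
  then show ?thesis by (simp add: powr_powr)
qed

lemma tensor_op_eq_poly_functional:
  assumes "N > 0"
  shows "tensor_op K N P x = poly_functional (\<lambda>z. z) (prod_weight N
    (\<lambda>i k. of_real (1 / sqrt (real N)) ^ k * K (monom 1 k) (sqrt (real N) * x i))) P"
  unfolding tensor_op_def poly_functional_def powr_neg_half[OF assms]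
  by (simp add: power_sum prod.distrib mult.assoc)

lemma poly_functional_plus_mpoly:
  "poly_functional (\<lambda>z. z) w (plus_mpoly N f)
    = (\<Sum>l\<le>degree f. coeff f l * poly_functional (\<lambda>z. z) w ((\<Sum>i<N. mvar i) ^ l))"
proof -
  have "plus_mpoly N f = (\<Sum>l\<le>degree f. Poly_Mapping.single 0 (coeff f l) * (\<Sum>i<N. mvar i) ^ l)"
  proof -
    have "degree (map_poly (Poly_Mapping.single (0 :: nat \<Rightarrow>\<^sub>0 nat)) f) = degree f"
      by (rule degree_map_poly) (metis lookup_single_eq lookup_zero)
    then show ?thesis
      unfolding plus_mpoly_def poly_altdef by (simp add: coeff_map_poly)
  qed
  then show ?thesis
    by (simp add: complex_self.poly_functional_sum complex_self.poly_functional_single_mult)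
qed

text \<open>
  The exponential generating function of the mixed moments of one coordinate after division by \<open>sqrt N\<close>.
\<close>

definition rescaled_egf :: "(nat \<Rightarrow> nat \<Rightarrow> complex) \<Rightarrow> nat \<Rightarrow> complex fps fps" where
  "rescaled_egf \<mu> N = complex_fps.egf (\<lambda>k. complex_self.egf
     (\<lambda>j. of_real (1 / sqrt (real N)) ^ (k + j) * \<mu> k j))"

lemma poly_functional_fps_nth:
  "poly_functional (\<lambda>z. z) (\<lambda>k. w k $ m) P = poly_functional fps_const w P $ m"
  by (simp add: poly_functional_def fps_sum_nth)

text \<open>
  The multinomial theorem is applied in both arguments.  The inner application produces generating functions in
  the second variable; these are the values of the functional in the outer application.
\<close>

lemma poly_functional_pair_var_sum_power:
  fixes \<nu> :: "nat \<Rightarrow> nat \<Rightarrow> complex"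
  shows "poly_functional (\<lambda>z. z) (\<lambda>k. poly_functional (\<lambda>z. z) (prod_weight N
      (\<lambda>i. \<nu> (Poly_Mapping.lookup k i))) ((\<Sum>i<N. mvar i) ^ m)) ((\<Sum>i<N. mvar i) ^ l)
    = fact l * fact m * (complex_fps.egf (\<lambda>k. complex_self.egf (\<nu> k)) ^ N) $ l $ m"
proof -
  define \<Phi> where "\<Phi> k = complex_self.egf (\<nu> k)" for k
  have inner: "poly_functional (\<lambda>z. z) (prod_weight N (\<lambda>i. \<nu> (Poly_Mapping.lookup k i)))
      ((\<Sum>i<N. mvar i) ^ m) = of_nat (fact m) * prod_weight N (\<lambda>i. \<Phi>) k $ m" for k
    unfolding \<Phi>_def
    by (rule complex_self.poly_functional_var_sum_power[where \<phi> = "\<lambda>i. \<nu> (Poly_Mapping.lookup k i)"])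
  have "poly_functional (\<lambda>z. z) (\<lambda>k. of_nat (fact m) * prod_weight N (\<lambda>i. \<Phi>) k $ m)
      ((\<Sum>i<N. mvar i) ^ l)
    = of_nat (fact m) * poly_functional (\<lambda>z. z) (\<lambda>k. prod_weight N (\<lambda>i. \<Phi>) k $ m)
        ((\<Sum>i<N. mvar i) ^ l)"
    by (simp only: poly_functional_def sum_distrib_left mult.left_commute)
  also have "\<dots> = of_nat (fact m) * (of_nat (fact l) * (\<Prod>i<N. complex_fps.egf \<Phi>) $ l) $ m"
    unfolding poly_functional_fps_nth
    by (simp only: complex_fps.poly_functional_var_sum_power[where \<phi> = "\<lambda>i. \<Phi>"])
  also have "\<dots> = fact l * fact m * (complex_fps.egf \<Phi> ^ N) $ l $ m"
    unfolding of_nat_fps_mult_nth prod_constant card_lessThan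
    by (simp only: of_nat_fact mult_ac)
  finally show ?thesis
    unfolding inner \<Phi>_def .
qed

lemma poly_functional_mult:
  "poly_functional (\<lambda>z. z) v P * poly_functional (\<lambda>z. z) w Q
    = poly_functional (\<lambda>z. z) (\<lambda>k. poly_functional (\<lambda>z. z) (\<lambda>j. v k * w j) Q) P"
  unfolding poly_functional_def sum_product by (simp add: sum_distrib_left mult_ac)

lemma rescaled_power_integral:
  fixes F :: "(nat \<Rightarrow> real) \<Rightarrow> complex"
  assumes "sets \<alpha> = sets borel" and [measurable]: "F \<in> borel_measurable (Pi\<^sub>M {..<N} (\<lambda>_. borel))"
  shows "(\<integral>x. F x \<partial>rescaled_power \<alpha> N)
    = (\<integral>y. F (\<lambda>i\<in>{..<N}. y i / sqrt (real N)) \<partial>Pi\<^sub>M {..<N} (\<lambda>_. \<alpha>))"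
proof -
  note [measurable_cong] = assms(1)
  show ?thesis
    unfolding rescaled_power_def by (rule integral_distr) measurable
qed

context
  fixes \<alpha> :: "real measure" and q :: real and K :: "complex poly \<Rightarrow> real \<Rightarrow> complex"
  assumes \<alpha>: "standardized \<alpha>" and q: "q > 1" and K: "linear_into_Lq \<alpha> q K"
begin

text \<open>
  By independence of the coordinates, the generating function of the mixed moments of \<open>N\<close> coordinates is the
  \<open>N\<close>-th power of that of one coordinate.
\<close>

lemma integral_tensor_op:
  assumes N: "N > 0"
  shows "(\<integral>x. tensor_op K N (plus_mpoly N f) x * poly g (of_real (\<Sum>i<N. x i)) \<partial>rescaled_power \<alpha> N)
    = (\<Sum>l\<le>degree f. \<Sum>m\<le>degree g. coeff f l * coeff g m *
        (fact l * fact m * (rescaled_egf (mixed_moment \<alpha> K) N ^ N) $ l $ m))"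
proof -
  define t where "t = complex_of_real (1 / sqrt (real N))"
  define \<nu> where "\<nu> k j = t ^ (k + j) * mixed_moment \<alpha> K k j" for k j
  define h where "h k j y = t ^ (k + j) * (K (monom 1 k) y * of_real y ^ j)" for k j y
  define S where "S l = (\<Sum>i<N. mvar i) ^ l" for l
  define A where "A l y = poly_functional (\<lambda>z. z)
    (prod_weight N (\<lambda>i k. t ^ k * K (monom 1 k) (y i))) (S l)" for l and y :: "nat \<Rightarrow> real"
  define B where "B m y = poly_functional (\<lambda>z. z)
    (prod_weight N (\<lambda>i j. (t * of_real (y i)) ^ j)) (S m)" for m and y :: "nat \<Rightarrow> real"
  interpret prob_space \<alpha> using standardizedD(1)[OF \<alpha>] .
  interpret product_sigma_finite "\<lambda>_::nat. \<alpha>" by unfold_locales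
  have [measurable]: "K p \<in> borel_measurable borel" for p
    by (rule K_measurable[OF \<alpha> q K])
  have int_h: "integrable \<alpha> (h k j)" for k j
    unfolding h_def by (intro integrable_mult_right integrable_K_power[OF \<alpha> q K])
  have h_mean: "(\<integral>y. h k j y \<partial>\<alpha>) = \<nu> k j" for k j
    by (simp add: h_def \<nu>_def mixed_moment_def)
  have AB: "A l y * B m y = (\<Sum>k\<in>Poly_Mapping.keys (S l). \<Sum>j\<in>Poly_Mapping.keys (S m).
      Poly_Mapping.lookup (S l) k * Poly_Mapping.lookup (S m) j *
        (\<Prod>i<N. h (Poly_Mapping.lookup k i) (Poly_Mapping.lookup j i) (y i)))" for l m y
    unfolding A_def B_def poly_functional_mult
    by (simp add: poly_functional_def h_def prod.distrib power_add power_mult_distrib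
        sum_distrib_left mult_ac)
  have int_prod: "integrable (Pi\<^sub>M {..<N} (\<lambda>_. \<alpha>)) (\<lambda>y. c * (\<Prod>i<N. h (k i) (j i) (y i)))"
    for c and k j :: "nat \<Rightarrow> nat"
    by (intro integrable_mult_right product_integrable_prod int_h) simp
  have integral_prod: "(\<integral>y. (\<Prod>i<N. h (k i) (j i) (y i)) \<partial>Pi\<^sub>M {..<N} (\<lambda>_. \<alpha>)) = (\<Prod>i<N. \<nu> (k i) (j i))"
    for k j :: "nat \<Rightarrow> nat"
    by (subst product_integral_prod) (simp_all add: int_h h_mean)
  have int_AB: "integrable (Pi\<^sub>M {..<N} (\<lambda>_. \<alpha>)) (\<lambda>y. A l y * B m y)" for l m
    unfolding AB by (intro Bochner_Integration.integrable_sum int_prod)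
  have "(\<integral>y. A l y * B m y \<partial>Pi\<^sub>M {..<N} (\<lambda>_. \<alpha>))
     = poly_functional (\<lambda>z. z) (\<lambda>k. poly_functional (\<lambda>z. z) (prod_weight N
      (\<lambda>i. \<nu> (Poly_Mapping.lookup k i))) (S m)) (S l)" for l m
    unfolding AB
    by (simp add: Bochner_Integration.integral_sum int_prod integral_prod
        poly_functional_def sum_distrib_left mult.assoc)
  also have "\<dots> l m = fact l * fact m * (rescaled_egf (mixed_moment \<alpha> K) N ^ N) $ l $ m" for l m
    unfolding S_def poly_functional_pair_var_sum_power
    by (simp add: rescaled_egf_def \<nu>_def[abs_def] t_def)
  finally have integral_AB: "(\<integral>y. A l y * B m y \<partial>Pi\<^sub>M {..<N} (\<lambda>_. \<alpha>))
      = fact l * fact m * (rescaled_egf (mixed_moment \<alpha> K) N ^ N) $ l $ m" for l m .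
  have t: "of_real (1 / sqrt (real N)) = t" by (simp add: t_def)
  have eval: "tensor_op K N (plus_mpoly N f) (\<lambda>i\<in>{..<N}. y i / sqrt (real N))
        * poly g (of_real (\<Sum>i<N. (\<lambda>i\<in>{..<N}. y i / sqrt (real N)) i))
      = (\<Sum>l\<le>degree f. \<Sum>m\<le>degree g. coeff f l * coeff g m * (A l y * B m y))" for y
  proof -
    have "tensor_op K N (plus_mpoly N f) (\<lambda>i\<in>{..<N}. y i / sqrt (real N))
        = (\<Sum>l\<le>degree f. coeff f l * A l y)"
      using N unfolding tensor_op_eq_poly_functional[OF N] poly_functional_plus_mpoly A_def S_def t
      by simp
    moreover have "B m y = of_real (\<Sum>i<N. (\<lambda>i\<in>{..<N}. y i / sqrt (real N)) i) ^ m" for m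
      using power_var_sum_eval[of 1 "\<lambda>i. t * of_real (y i)" N m]
      by (simp add: B_def S_def t_def)
    ultimately show ?thesis
      by (simp add: poly_altdef sum_product mult_ac)
  qed
  have meas: "(\<lambda>x. tensor_op K N (plus_mpoly N f) x * poly g (of_real (\<Sum>i<N. x i)))
      \<in> borel_measurable (Pi\<^sub>M {..<N} (\<lambda>_. borel))"
    unfolding tensor_op_def poly_altdef by measurable
  have "(\<integral>x. tensor_op K N (plus_mpoly N f) x * poly g (of_real (\<Sum>i<N. x i)) \<partial>rescaled_power \<alpha> N)
    = (\<integral>y. (\<Sum>l\<le>degree f. \<Sum>m\<le>degree g. coeff f l * coeff g m * (A l y * B m y)) \<partial>Pi\<^sub>M {..<N} (\<lambda>_. \<alpha>))"
    unfolding rescaled_power_integral[OF standardizedD(2)[OF \<alpha>] meas] eval ..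
  also have "\<dots> = (\<Sum>l\<le>degree f. \<Sum>m\<le>degree g. coeff f l * coeff g m *
        (\<integral>y. A l y * B m y \<partial>Pi\<^sub>M {..<N} (\<lambda>_. \<alpha>)))"
    by (simp add: Bochner_Integration.integral_sum int_AB)
  finally show ?thesis unfolding integral_AB .
qed

end

lemma rescaled_egf_nth:
  "rescaled_egf \<mu> N $ i $ j = of_real (1 / sqrt (real N)) ^ (i + j) * \<mu> i j / (fact i * fact j)"
  by (simp add: rescaled_egf_def complex_fps.egf_def complex_self.egf_def)

lemma tendsto_rescaled:
  assumes "n \<ge> 1" "n = 1 \<Longrightarrow> v = 0"
  shows "(\<lambda>N. of_nat N * (of_real (1 / sqrt (real N)) ^ n * v)) \<longlonglongrightarrow> (if n = 2 then v else 0 :: complex)"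
proof (cases "n = 1")
  case False
  then obtain d where n: "n = d + 2" using assms(1) by (metis One_nat_def add.commute le_Suc_ex le_antisym not_less_eq_eq numeral_2_eq_2)
  have "(\<lambda>N. 1 / sqrt (real N)) \<longlonglongrightarrow> 0"
    by (intro tendsto_divide_0[OF tendsto_const] filterlim_at_top_imp_at_infinity
        filterlim_compose[OF sqrt_at_top filterlim_real_sequentially])
  then have "(\<lambda>N. of_real (1 / sqrt (real N)) ^ d * v) \<longlonglongrightarrow> of_real 0 ^ d * v"
    by (intro tendsto_intros)
  also have "of_real 0 ^ d * v = (if n = 2 then v else 0)"
    by (simp add: n power_0_left)
  finally show ?thesis
  proof (rule Lim_transform_eventually)
    show "\<forall>\<^sub>F N in sequentially. of_real (1 / sqrt (real N)) ^ d * v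
        = of_nat N * (of_real (1 / sqrt (real N)) ^ n * v)"
      using eventually_gt_at_top[of 0]
    proof eventually_elim
      case (elim N)
      have "of_nat N * of_real (1 / sqrt (real N)) ^ 2 = (of_real (real N * (1 / sqrt (real N))\<^sup>2) :: complex)"
        by simp
      also have "real N * (1 / sqrt (real N))\<^sup>2 = 1"
        using elim by (simp add: power_divide)
      finally have one: "of_nat N * of_real (1 / sqrt (real N)) ^ 2 = (1 :: complex)"
        by simp
      have "of_nat N * (of_real (1 / sqrt (real N)) ^ n * v)
          = (of_nat N * of_real (1 / sqrt (real N)) ^ 2) * (of_real (1 / sqrt (real N)) ^ d * v)"
        by (simp only: n power_add mult_ac)
      then show ?case
        by (simp only: one mult_1_left)
    qed
  qed
qed (use assms in auto)

section \<open>The limit and its identification\<close>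

text \<open>
  Multiplied by \<open>N\<close>, the coefficients of degree two are constant, those of higher degree vanish in the
  limit, and those of degree one, which would grow like \<open>sqrt N\<close>, are zero.
\<close>

lemma tendsto_rescaled_egf_power:
  assumes "\<mu> 0 0 = 1" "\<mu> 1 0 = 0" "\<mu> 0 1 = 0"
  shows "(\<lambda>N. fact l * fact m * (rescaled_egf \<mu> N ^ N) $ l $ m)
    \<longlonglongrightarrow> gaussian_form (\<mu> 2 0) (\<mu> 1 1) (\<mu> 0 2) l m"
proof -
  define P Q R where "P = \<mu> 2 0" and "Q = \<mu> 1 1" and "R = \<mu> 0 2"
  have "(\<lambda>N. (rescaled_egf \<mu> N ^ (N - 0)) $ l $ m) \<longlonglongrightarrow> gaussian_egf P Q R $ l $ m"
  proof (rule tendsto_fps_power_of_triangular_array)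
    show "\<forall>\<^sub>F N in sequentially. rescaled_egf \<mu> N $ 0 $ 0 = 1"
      by (simp add: rescaled_egf_nth assms)
    show "gaussian_egf P Q R $ 0 $ 0 = 1"
      by (simp add: gaussian_egf_nth)
    show "(\<lambda>N. of_nat N * fps_deriv (rescaled_egf \<mu> N) $ i $ j) \<longlonglongrightarrow>
        (fps_const (fps_const P) * fps_X + fps_const (fps_const Q * fps_X)) $ i $ j" for i j
    proof -
      have "fps_deriv (rescaled_egf \<mu> N) $ i $ j
          = of_real (1 / sqrt (real N)) ^ (Suc i + j) * (\<mu> (Suc i) j / (fact i * fact j))" for N
        by (simp add: fps_deriv_nth_nth rescaled_egf_nth del: fps_deriv_nth of_nat_Suc)
      then have "(\<lambda>N. of_nat N * fps_deriv (rescaled_egf \<mu> N) $ i $ j) \<longlonglongrightarrow>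
          (if Suc i + j = 2 then \<mu> (Suc i) j / (fact i * fact j) else 0)"
        using assms by (simp only:) (rule tendsto_rescaled, auto)
      also have "(if Suc i + j = 2 then \<mu> (Suc i) j / (fact i * fact j) else 0)
          = (fps_const (fps_const P) * fps_X + fps_const (fps_const Q * fps_X)) $ i $ j"
      proof -
        consider "i = 1" "j = 0" | "i = 0" "j = 1" | "Suc i + j \<noteq> 2" by arith
        then show ?thesis
          by cases (auto simp: P_def Q_def fps_X_def numeral_2_eq_2)
      qed
      finally show ?thesis .
    qed
    show "(\<lambda>N. of_nat N * fps_deriv (rescaled_egf \<mu> N $ 0) $ j) \<longlonglongrightarrow> (fps_const R * fps_X) $ j" for j
    proof -
      have "fps_deriv (rescaled_egf \<mu> N $ 0) $ j
          = of_real (1 / sqrt (real N)) ^ Suc j * (\<mu> 0 (Suc j) / fact j)" for N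
        by (simp add: rescaled_egf_nth del: of_nat_Suc)
      then have "(\<lambda>N. of_nat N * fps_deriv (rescaled_egf \<mu> N $ 0) $ j) \<longlonglongrightarrow>
          (if Suc j = 2 then \<mu> 0 (Suc j) / fact j else 0)"
        using assms by (simp only:) (rule tendsto_rescaled, auto)
      also have "(if Suc j = 2 then \<mu> 0 (Suc j) / fact j else 0) = (fps_const R * fps_X) $ j"
        by (auto simp: R_def fps_X_def numeral_2_eq_2)
      finally show ?thesis .
    qed
  qed (rule fps_deriv_gaussian_egf fps_deriv_gaussian_egf_0)+
  then have "(\<lambda>N. fact l * fact m * (rescaled_egf \<mu> N ^ N) $ l $ m)
      \<longlonglongrightarrow> fact l * fact m * gaussian_egf P Q R $ l $ m"
    by (intro tendsto_mult_left) simp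
  then show ?thesis
    by (simp add: gaussian_egf_nth P_def Q_def R_def)
qed

definition gaussian_bilinear ::
  "complex \<Rightarrow> complex \<Rightarrow> complex \<Rightarrow> complex poly \<Rightarrow> complex poly \<Rightarrow> complex" where
  "gaussian_bilinear P Q R f g
    = (\<Sum>l\<le>degree f. \<Sum>m\<le>degree g. coeff f l * coeff g m * gaussian_form P Q R l m)"

lemma gaussian_bilinear_monom:
  "gaussian_bilinear P Q R (monom 1 l) (monom 1 m) = gaussian_form P Q R l m"
proof -
  have "gaussian_bilinear P Q R (monom 1 l) (monom 1 m)
      = (\<Sum>i\<le>l. \<Sum>j\<le>m. if i = l \<and> j = m then gaussian_form P Q R l m else 0)"
    unfolding gaussian_bilinear_def degree_monom_eq[OF one_neq_zero]
    by (intro sum.cong) auto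
  also have "\<dots> = (\<Sum>i\<le>l. if i = l then gaussian_form P Q R l m else 0)"
    by (intro sum.cong) auto
  finally show ?thesis by simp
qed

text \<open>
  The parameters are recovered by evaluating on \<open>(x\<^sup>2, 1)\<close>, \<open>(x, x)\<close> and \<open>(1, x\<^sup>2)\<close>.
\<close>

lemma gaussian_bilinear_inject:
  "(\<forall>f g. gaussian_bilinear P Q R f g = gaussian_bilinear P' Q' R' f g)
    \<longleftrightarrow> P = P' \<and> Q = Q' \<and> R = R'" (is "?L \<longleftrightarrow> ?R")
proof
  assume ?L
  then have eq: "gaussian_form P Q R l m = gaussian_form P' Q' R' l m" for l m
    unfolding gaussian_bilinear_monom[symmetric] by blast
  show ?R
    using eq[of 2 0] eq[of 1 1] eq[of 0 2] by (simp add: numeral_2_eq_2)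
qed auto

text \<open>
  The parameters are the second mixed moments.  They differ from the matrix coefficients because \<open>x\<^sup>2\<close> is the
  second Hermite polynomial plus \<open>1\<close>.
\<close>

lemma central_limit_integral:
  assumes \<alpha>: "standardized \<alpha>" and q: "q > 1" and K: "linear_into_Lq \<alpha> q K"
    and "matrix_coeff \<alpha> K 0 0 = 1" "matrix_coeff \<alpha> K 0 1 = 0" "matrix_coeff \<alpha> K 1 0 = 0"
  shows "(\<lambda>N. \<integral>x. tensor_op K N (plus_mpoly N f) x * poly g (of_real (\<Sum>i<N. x i)) \<partial>rescaled_power \<alpha> N)
    \<longlonglongrightarrow> gaussian_bilinear (1 + matrix_coeff \<alpha> K 2 0) (matrix_coeff \<alpha> K 1 1)
        (1 + matrix_coeff \<alpha> K 0 2) f g"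
proof -
  note low = matrix_coeff_low[OF \<alpha> q K]
  have \<mu>: "mixed_moment \<alpha> K 0 0 = 1" "mixed_moment \<alpha> K 1 0 = 0" "mixed_moment \<alpha> K 0 1 = 0"
    using assms low by simp_all
  have PQR: "1 + matrix_coeff \<alpha> K 2 0 = mixed_moment \<alpha> K 2 0"
      "matrix_coeff \<alpha> K 1 1 = mixed_moment \<alpha> K 1 1"
      "1 + matrix_coeff \<alpha> K 0 2 = mixed_moment \<alpha> K 0 2"
    unfolding low using \<mu> by simp_all
  have "(\<lambda>N. \<Sum>l\<le>degree f. \<Sum>m\<le>degree g. coeff f l * coeff g m *
        (fact l * fact m * (rescaled_egf (mixed_moment \<alpha> K) N ^ N) $ l $ m))
      \<longlonglongrightarrow> gaussian_bilinear (1 + matrix_coeff \<alpha> K 2 0) (matrix_coeff \<alpha> K 1 1)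
        (1 + matrix_coeff \<alpha> K 0 2) f g"
    unfolding gaussian_bilinear_def PQR
    by (intro tendsto_sum tendsto_mult_left tendsto_rescaled_egf_power \<mu>)
  then show ?thesis
  proof (rule Lim_transform_eventually)
    show "\<forall>\<^sub>F N in sequentially. (\<Sum>l\<le>degree f. \<Sum>m\<le>degree g. coeff f l * coeff g m *
        (fact l * fact m * (rescaled_egf (mixed_moment \<alpha> K) N ^ N) $ l $ m))
      = (\<integral>x. tensor_op K N (plus_mpoly N f) x * poly g (of_real (\<Sum>i<N. x i)) \<partial>rescaled_power \<alpha> N)"
      using eventually_gt_at_top[of 0]
      by eventually_elim (simp only: integral_tensor_op[OF \<alpha> q K])
  qed
qed

lemma M_T_S_apply:
  "(M_op \<tau> \<circ> T_op \<omega> \<circ> S_op c) f x = gaussian_weight \<tau> x * poly (TS_op \<omega> c f) (of_real x)"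
  by (simp add: M_op_def gaussian_weight_def TS_op_def)

lemma integral_M_T_S:
  assumes \<tau>: "Re \<tau> > - 1"
  shows "(\<integral>x. (M_op \<tau> \<circ> T_op \<omega> \<circ> S_op c) f x * poly g (of_real x) \<partial>std_normal_distribution)
    = gaussian_bilinear (c\<^sup>2 - \<tau> / (1 + \<tau>) * (c * \<omega>)\<^sup>2) (c * \<omega> / (1 + \<tau>)) (1 / (1 + \<tau>)) f g"
proof -
  have gf_sum: "gaussian_functional \<tau> (sum p A) = (\<Sum>i\<in>A. gaussian_functional \<tau> (p i))"
    for p :: "nat \<Rightarrow> complex poly" and A
    using gaussian_functional_smult[OF \<tau>, of 0 0]
    by (induction A rule: infinite_finite_induct) (simp_all add: gaussian_functional_add[OF \<tau>])
  have TS_sum: "TS_op \<omega> c (sum p A) = (\<Sum>i\<in>A. TS_op \<omega> c (p i))" for p :: "nat \<Rightarrow> complex poly" and A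
    using TS_op_smult[of \<omega> c 0 0]
    by (induction A rule: infinite_finite_induct) (simp_all add: TS_op_add)
  have expand: "h = (\<Sum>l\<le>degree h. smult (coeff h l) (monom 1 l))" for h :: "complex poly"
    by (simp add: smult_monom poly_as_sum_of_monoms)
  have "(\<integral>x. (M_op \<tau> \<circ> T_op \<omega> \<circ> S_op c) f x * poly g (of_real x) \<partial>std_normal_distribution)
      = gaussian_functional \<tau> (TS_op \<omega> c f * g)"
    by (simp only: M_T_S_apply gaussian_functional_def poly_mult mult.assoc)
  also have "TS_op \<omega> c f * g = (\<Sum>l\<le>degree f. smult (coeff f l) (TS_op \<omega> c (monom 1 l)))
      * (\<Sum>m\<le>degree g. smult (coeff g m) (monom 1 m))"
  proof (rule arg_cong2[of _ _ _ _ "(*)"])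
    have "TS_op \<omega> c f = TS_op \<omega> c (\<Sum>l\<le>degree f. smult (coeff f l) (monom 1 l))"
      by (rule arg_cong[OF expand])
    then show "TS_op \<omega> c f = (\<Sum>l\<le>degree f. smult (coeff f l) (TS_op \<omega> c (monom 1 l)))"
      unfolding TS_sum TS_op_smult .
  qed (rule expand)
  also have "\<dots> = (\<Sum>l\<le>degree f. \<Sum>m\<le>degree g.
      smult (coeff f l * coeff g m) (TS_op \<omega> c (monom 1 l) * monom 1 m))"
    unfolding sum_product by (simp only: mult_smult_left mult_smult_right smult_smult mult.commute[of "coeff g _"])
  also have "gaussian_functional \<tau> \<dots> = gaussian_bilinear (c\<^sup>2 - \<tau> / (1 + \<tau>) * (c * \<omega>)\<^sup>2)
      (c * \<omega> / (1 + \<tau>)) (1 / (1 + \<tau>)) f g"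
    by (simp only: gf_sum gaussian_functional_smult[OF \<tau>] gaussian_functional_TS_op[OF \<tau> refl refl refl]
        gaussian_bilinear_def)
  finally show ?thesis .
qed

lemma gaussian_parameters_iff:
  fixes \<tau> c \<omega> k20 k11 k02 :: complex
  assumes \<tau>: "Re \<tau> > - 1" and k02: "Re k02 > - 1"
  shows "(c\<^sup>2 - \<tau> / (1 + \<tau>) * (c * \<omega>)\<^sup>2 = 1 + k20 \<and> c * \<omega> / (1 + \<tau>) = k11 \<and> 1 / (1 + \<tau>) = 1 + k02)
    \<longleftrightarrow> (\<tau> = - k02 / (1 + k02) \<and> c\<^sup>2 = 1 + k20 + \<tau> * (1 + \<tau>) * k11\<^sup>2 \<and> c * \<omega> = (1 + \<tau>) * k11)"
proof -
  have nz: "1 + \<tau> \<noteq> 0" "1 + k02 \<noteq> 0"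
    using \<tau> k02 by (auto simp: complex_eq_iff)
  have R: "1 / (1 + \<tau>) = 1 + k02 \<longleftrightarrow> \<tau> = - k02 / (1 + k02)"
    using nz by (simp add: field_simps) (auto simp: algebra_simps eq_neg_iff_add_eq_0)
  have Q: "c * \<omega> / (1 + \<tau>) = k11 \<longleftrightarrow> c * \<omega> = (1 + \<tau>) * k11"
    using nz by (simp add: field_simps)
  have "\<tau> / (1 + \<tau>) * ((1 + \<tau>) * k11)\<^sup>2 = \<tau> * (1 + \<tau>) * k11\<^sup>2"
    using nz by (simp add: power2_eq_square)
  then have P: "c\<^sup>2 - \<tau> / (1 + \<tau>) * (c * \<omega>)\<^sup>2 = 1 + k20 \<longleftrightarrow> c\<^sup>2 = 1 + k20 + \<tau> * (1 + \<tau>) * k11\<^sup>2"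
    if "c * \<omega> = (1 + \<tau>) * k11"
    unfolding that by (simp add: diff_eq_eq)
  show ?thesis using P Q R by blast
qed

text \<open>
  Both sides of the limit are Gaussian bilinear forms, so equality of the forms is equality of three parameters.
\<close>

lemma central_limit_of_M_T_S_iff:
  assumes "standardized \<alpha>" "q > 1" "linear_into_Lq \<alpha> q K"
    and "matrix_coeff \<alpha> K 0 0 = 1" "matrix_coeff \<alpha> K 0 1 = 0" "matrix_coeff \<alpha> K 1 0 = 0"
    and k02: "Re (matrix_coeff \<alpha> K 0 2) > - 1" and \<tau>: "Re \<tau> > - 1"
  shows "central_limit_of \<alpha> K (M_op \<tau> \<circ> T_op \<omega> \<circ> S_op c) \<longleftrightarrow>
    \<tau> = - matrix_coeff \<alpha> K 0 2 / (1 + matrix_coeff \<alpha> K 0 2) \<and>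
    c\<^sup>2 = 1 + matrix_coeff \<alpha> K 2 0 + \<tau> * (1 + \<tau>) * (matrix_coeff \<alpha> K 1 1)\<^sup>2 \<and>
    c * \<omega> = (1 + \<tau>) * matrix_coeff \<alpha> K 1 1"
proof -
  have "(\<lambda>N. \<integral>x. tensor_op K N (plus_mpoly N f) x * poly g (of_real (\<Sum>i<N. x i)) \<partial>rescaled_power \<alpha> N)
      \<longlonglongrightarrow> L \<longleftrightarrow> L = gaussian_bilinear (1 + matrix_coeff \<alpha> K 2 0) (matrix_coeff \<alpha> K 1 1)
        (1 + matrix_coeff \<alpha> K 0 2) f g" for f g L
    using central_limit_integral[OF assms(1-6), of f g] LIMSEQ_unique by blast
  then show ?thesis
    unfolding central_limit_of_def integral_M_T_S[OF \<tau>]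
    by (simp only: gaussian_bilinear_inject gaussian_parameters_iff[OF \<tau> k02])
qed

lemma M_T_S_eqI:
  assumes "c\<^sup>2 = c'\<^sup>2" "c * \<omega> = c' * \<omega>'"
  shows "M_op \<tau> \<circ> T_op \<omega> \<circ> S_op c = M_op \<tau> \<circ> T_op \<omega>' \<circ> S_op c'"
  by (intro ext) (simp only: M_T_S_apply TS_op_eqI[OF assms])

theorem theorem1:
  fixes \<alpha> :: "real measure" and q :: real and K :: "complex poly \<Rightarrow> real \<Rightarrow> complex"
  assumes "standardized \<alpha>"
    and "q > 1"
    and "linear_into_Lq \<alpha> q K"
    and "matrix_coeff \<alpha> K 0 0 = 1"
    and "matrix_coeff \<alpha> K 0 1 = 0"
    and "matrix_coeff \<alpha> K 1 0 = 0"
    and "Re (matrix_coeff \<alpha> K 0 2) > -1"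
    and nondegenerate: "matrix_coeff \<alpha> K 1 1 \<noteq> 0 \<longrightarrow>
      (1 + matrix_coeff \<alpha> K 2 0) * (1 + matrix_coeff \<alpha> K 0 2)\<^sup>2
        \<noteq> matrix_coeff \<alpha> K 0 2 * (matrix_coeff \<alpha> K 1 1)\<^sup>2"
  shows "(\<exists>!C. C \<in> centered_gaussian_operators \<and> central_limit_of \<alpha> K C) \<and>
    (\<forall>C. C \<in> centered_gaussian_operators \<and> central_limit_of \<alpha> K C \<longrightarrow>
      (\<forall>c \<omega> \<tau> :: complex. Re \<tau> > -1 \<longrightarrow>
        (C = M_op \<tau> \<circ> T_op \<omega> \<circ> S_op c \<longleftrightarrow>
          \<tau> = - matrix_coeff \<alpha> K 0 2 / (1 + matrix_coeff \<alpha> K 0 2) \<and>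
          c\<^sup>2 = 1 + matrix_coeff \<alpha> K 2 0 + \<tau> * (1 + \<tau>) * (matrix_coeff \<alpha> K 1 1)\<^sup>2 \<and>
          c * \<omega> = (1 + \<tau>) * matrix_coeff \<alpha> K 1 1)))"
proof -
  define params where "params c \<omega> \<tau> \<longleftrightarrow>
      \<tau> = - matrix_coeff \<alpha> K 0 2 / (1 + matrix_coeff \<alpha> K 0 2) \<and>
      c\<^sup>2 = 1 + matrix_coeff \<alpha> K 2 0 + \<tau> * (1 + \<tau>) * (matrix_coeff \<alpha> K 1 1)\<^sup>2 \<and>
      c * \<omega> = (1 + \<tau>) * matrix_coeff \<alpha> K 1 1" for c \<omega> \<tau>
  define op where "op c \<omega> \<tau> = M_op \<tau> \<circ> T_op \<omega> \<circ> S_op c" for c \<omega> \<tau>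
  have limit_iff: "central_limit_of \<alpha> K (op c \<omega> \<tau>) \<longleftrightarrow> params c \<omega> \<tau>" if "Re \<tau> > - 1" for c \<omega> \<tau>
    unfolding op_def params_def by (rule central_limit_of_M_T_S_iff[OF assms(1-7) that])
  have op_eq: "op c \<omega> \<tau> = op c' \<omega>' \<tau>'" if "params c \<omega> \<tau>" "params c' \<omega>' \<tau>'" for c \<omega> \<tau> c' \<omega>' \<tau>'
  proof -
    have "\<tau> = \<tau>'" using that by (simp add: params_def)
    then show ?thesis
      using that M_T_S_eqI[of c c' \<omega> \<omega>' \<tau>] by (simp add: op_def params_def)
  qed
  have family: "C \<in> centered_gaussian_operators \<longleftrightarrow> (\<exists>c \<omega> \<tau>. Re \<tau> > - 1 \<and> C = op c \<omega> \<tau>)" for C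
    unfolding centered_gaussian_operators_def op_def by blast
  obtain c0 \<omega>0 \<tau>0 where 0: "Re \<tau>0 > - 1" "params c0 \<omega>0 \<tau>0"
    using gaussian_parameters_exist_iff[OF assms(7)] nondegenerate unfolding params_def by blast
  have limit_unique: "C \<in> centered_gaussian_operators \<and> central_limit_of \<alpha> K C \<longleftrightarrow> C = op c0 \<omega>0 \<tau>0" for C
  proof
    assume C: "C \<in> centered_gaussian_operators \<and> central_limit_of \<alpha> K C"
    then obtain c \<omega> \<tau> where "Re \<tau> > - 1" and "C = op c \<omega> \<tau>"
      using family by blast
    then show "C = op c0 \<omega>0 \<tau>0"
      using C limit_iff op_eq 0(2) by blast
  next
    assume "C = op c0 \<omega>0 \<tau>0"
    then show "C \<in> centered_gaussian_operators \<and> central_limit_of \<alpha> K C"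
      using family limit_iff 0 by blast
  qed
  have representation: "op c0 \<omega>0 \<tau>0 = op c \<omega> \<tau> \<longleftrightarrow> params c \<omega> \<tau>" if "Re \<tau> > - 1" for c \<omega> \<tau>
  proof
    assume "op c0 \<omega>0 \<tau>0 = op c \<omega> \<tau>"
    then have "central_limit_of \<alpha> K (op c \<omega> \<tau>)"
      using limit_iff[OF 0(1), of c0 \<omega>0] 0(2) by (simp only:)
    then show "params c \<omega> \<tau>" using limit_iff that by blast
  next
    assume "params c \<omega> \<tau>"
    then show "op c0 \<omega>0 \<tau>0 = op c \<omega> \<tau>" by (rule op_eq[OF 0(2)])
  qed
  show ?thesis
  proof (intro conjI allI impI)
    show "\<exists>!C. C \<in> centered_gaussian_operators \<and> central_limit_of \<alpha> K C"
      unfolding limit_unique by blast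
  next
    fix C c \<omega> \<tau>
    assume C: "C \<in> centered_gaussian_operators \<and> central_limit_of \<alpha> K C" and "Re \<tau> > - 1"
    from C have "C = op c0 \<omega>0 \<tau>0" unfolding limit_unique .
    with representation[OF \<open>Re \<tau> > - 1\<close>, of c \<omega>]
    have "C = op c \<omega> \<tau> \<longleftrightarrow> params c \<omega> \<tau>" by (simp only:)
    then show "C = M_op \<tau> \<circ> T_op \<omega> \<circ> S_op c \<longleftrightarrow>
        \<tau> = - matrix_coeff \<alpha> K 0 2 / (1 + matrix_coeff \<alpha> K 0 2) \<and>
        c\<^sup>2 = 1 + matrix_coeff \<alpha> K 2 0 + \<tau> * (1 + \<tau>) * (matrix_coeff \<alpha> K 1 1)\<^sup>2 \<and>
        c * \<omega> = (1 + \<tau>) * matrix_coeff \<alpha> K 1 1"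
      unfolding op_def params_def .
  qed
qed

end
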